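(* In $\mathsf{THS}$, there does not exist a hyperfinite computer arithmetic $R=(\langle r;\oplus,\odot\rangle;R_b,\rho)$ such that $\langle r;\oplus,\odot\rangle$ is an associative ring (not necessarily commutative).
   Context: $\mathsf{THS}$ is a first-order class theory in the language $\{\in\}$; sets are classes that are members of classes. Axioms: extensionality; class comprehension for arbitrary formulas; $\emptyset$ and $x\cup\{y\}$ are sets; $\in$-induction $\varphi(\emptyset)\wedge\forall x,y(\varphi(x)\wedge\varphi(y)\to\varphi(x\cup\{y\}))\to\forall x\varphi(x)$ for set formulas; (Thin) thin classes are contained in sets; (Comp) for thin $X$ and set $u\subseteq\bigcup X$ there is a set $x\subseteq X$ with $u\subseteq\bigcup x$; (Exp) for thin $X$ there is thin $P$ with $\forall y\exists p\in P(y\cap X=p\cap X)$; Choice for classes with thin domain; dependent choices along $\mathbb{SN}$ (smallest class containing $\emptyset$ closed under $n\mapsto n\cup\{n\}$); transfer of set formulas to standard sets. A class is small iff every subclass is a set; infinite iff not small; thin iff every subset is small. A $\sigma$-class is the union of a thin class; a $\pi$-class is the intersection of a thin class. $\mathbb{R}$ is a fixed thin field of real numbers (a linearly ordered field in which every bounded above subclass has a supremum), with its usual order topology. A hyperfinite computer arithmetic is a tuple $(\langle r;\oplus,\odot\rangle;R_b,\rho)$ where $r$ is a set with binary operations $\oplus,\odot$, $R_b\subseteq r$ is a $\sigma$-class and $\rho$ is a $\pi$-equivalence relation on $r$ such that: (a) $\rho$ is an indiscernibility relation on $R_b$, i.e. every infinite set $u\subseteq R_b$ contains $a\neq b$ with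 $a\rho b$; (b) $R_b$ is closed under $\oplus,\odot$; (c) $\rho$ is a congruence on $\langle R_b;\oplus,\odot\rangle$; (d) the quotient algebra $R_b/\rho$ is topologically isomorphic to the field $\mathbb{R}$. Here the quotient is realized on a thin class $N\subseteq R_b$ containing exactly one element of each $\rho$-class, with the topology having as base the classes $\mathring u\cap N$ for sets $u\subseteq R_b$, where $\mathring u=\{a\in u:\forall b\in R_b(a\rho b\to b\in u)\}$. *)

theory Defs
  imports "HOL-Algebra.Ring"
begin

text \<open>
  Theorems of the first-order theory \<open>THS\<close> are read semantically: a statement is proved for every
  structure \<open>('c, mem)\<close> satisfying the axioms. The elements of \<open>'c\<close> are the classes of the
  structure. Quantifiers over classes must range over \<open>'c\<close> and never over \<open>'c set\<close>, because a HOL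
  set of elements need not be the extension of a class. For the same reason the axiom schemas
  range over the following formulas and not over HOL predicates.
\<close>

datatype fm = Mem nat nat | Eq nat nat | Neg fm | Conj fm fm | All nat fm

definition associative_ring :: "'a set \<Rightarrow> ('a \<Rightarrow> 'a \<Rightarrow> 'a) \<Rightarrow> ('a \<Rightarrow> 'a \<Rightarrow> 'a) \<Rightarrow> bool" where
  \<comment> \<open>no unit is required, in contrast to the locale \<open>ring\<close>\<close>
  "associative_ring A pl ml \<longleftrightarrow>
     (\<exists>z. comm_group \<lparr>carrier = A, mult = pl, one = z\<rparr>) \<and>
     (\<forall>a\<in>A. \<forall>b\<in>A. ml a b \<in> A) \<and>
     (\<forall>a\<in>A. \<forall>b\<in>A. \<forall>c\<in>A. ml (ml a b) c = ml a (ml b c)) \<and>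
     (\<forall>a\<in>A. \<forall>b\<in>A. \<forall>c\<in>A. ml a (pl b c) = pl (ml a b) (ml a c)) \<and>
     (\<forall>a\<in>A. \<forall>b\<in>A. \<forall>c\<in>A. ml (pl a b) c = pl (ml a c) (ml b c))"

locale membership =
  fixes mem :: "'c \<Rightarrow> 'c \<Rightarrow> bool"  (infix \<open>\<epsilon>\<close> 50)
begin

primrec sat :: "'c set \<Rightarrow> (nat \<Rightarrow> 'c) \<Rightarrow> fm \<Rightarrow> bool" where
  \<comment> \<open>quantifiers relativized to \<open>D\<close>\<close>
  "sat D e (Mem i j) \<longleftrightarrow> e i \<epsilon> e j"
| "sat D e (Eq i j) \<longleftrightarrow> e i = e j"
| "sat D e (Neg \<phi>) \<longleftrightarrow> \<not> sat D e \<phi>"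
| "sat D e (Conj \<phi> \<psi>) \<longleftrightarrow> sat D e \<phi> \<and> sat D e \<psi>"
| "sat D e (All i \<phi>) \<longleftrightarrow> (\<forall>x\<in>D. sat D (e(i := x)) \<phi>)"

definition isset :: "'c \<Rightarrow> bool" where
  "isset x \<longleftrightarrow> (\<exists>Y. x \<epsilon> Y)"

definition elts :: "'c \<Rightarrow> 'c set" where
  "elts X = {x. x \<epsilon> X}"

definition empty_class :: 'c where
  "empty_class = (THE w. elts w = {})"

definition adjoin :: "'c \<Rightarrow> 'c \<Rightarrow> 'c" where
  "adjoin x y = (THE w. elts w = insert y (elts x))"

definition pair :: "'c \<Rightarrow> 'c \<Rightarrow> 'c" where
  \<comment> \<open>Kuratowski pair \<open>{{a}, {a, b}}\<close>; meaningful for sets \<open>a\<close>, \<open>b\<close> only\<close>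
  "pair a b = adjoin (adjoin empty_class (adjoin empty_class a))
                     (adjoin (adjoin empty_class a) b)"

definition rel :: "'c \<Rightarrow> 'c \<Rightarrow> 'c \<Rightarrow> bool" where
  "rel R x y \<longleftrightarrow> isset x \<and> isset y \<and> pair x y \<epsilon> R"

definition is_relation_on :: "'c \<Rightarrow> 'c \<Rightarrow> bool" where
  "is_relation_on R A \<longleftrightarrow> elts R \<subseteq> {pair x y | x y. x \<in> elts A \<and> y \<in> elts A}"

definition dom_of :: "'c \<Rightarrow> 'c set" where
  "dom_of R = {x. \<exists>y. rel R x y}"

definition is_function :: "'c \<Rightarrow> bool" where
  "is_function F \<longleftrightarrow>
     (\<forall>p\<in>elts F. \<exists>x y. isset x \<and> isset y \<and> p = pair x y) \<and>
     (\<forall>x y y'. rel F x y \<longrightarrow> rel F x y' \<longrightarrow> y = y')"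

definition app :: "'c \<Rightarrow> 'c \<Rightarrow> 'c" where
  "app F x = (THE y. rel F x y)"

definition is_map :: "'c \<Rightarrow> 'c set \<Rightarrow> 'c set \<Rightarrow> bool" where
  "is_map F D B \<longleftrightarrow> is_function F \<and> dom_of F = D \<and> app F ` D \<subseteq> B"

definition binop_on :: "'c \<Rightarrow> 'c \<Rightarrow> bool" where
  "binop_on f A \<longleftrightarrow> is_map f {pair a b | a b. a \<in> elts A \<and> b \<in> elts A} (elts A)"

definition app2 :: "'c \<Rightarrow> 'c \<Rightarrow> 'c \<Rightarrow> 'c" where
  "app2 f a b = app f (pair a b)"

definition small :: "'c \<Rightarrow> bool" where
  "small X \<longleftrightarrow> (\<forall>Y. elts Y \<subseteq> elts X \<longrightarrow> isset Y)"

definition thin :: "'c \<Rightarrow> bool" where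
  "thin X \<longleftrightarrow> (\<forall>u. isset u \<and> elts u \<subseteq> elts X \<longrightarrow> small u)"

definition sigma_class :: "'c \<Rightarrow> bool" where
  "sigma_class X \<longleftrightarrow> (\<exists>T. thin T \<and> elts X = {x. \<exists>t\<in>elts T. x \<epsilon> t})"

definition pi_class :: "'c \<Rightarrow> bool" where
  "pi_class X \<longleftrightarrow> (\<exists>T. thin T \<and> elts X = {x. isset x \<and> (\<forall>t\<in>elts T. x \<epsilon> t)})"

definition SN :: "'c set" where
  "SN = {n. \<forall>X. empty_class \<epsilon> X \<and> (\<forall>m\<in>elts X. adjoin m m \<epsilon> X) \<longrightarrow> n \<epsilon> X}"

definition standard :: "'c set" where
  \<comment> \<open>the hereditarily small (i.e. standardly finite) sets\<close>
  "standard = {s. \<forall>X. empty_class \<epsilon> X \<and> (\<forall>x\<in>elts X. \<forall>y\<in>elts X. adjoin x y \<epsilon> X) \<longrightarrow> s \<epsilon> X}"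

end

locale THS = membership +
  assumes extensionality: "elts X = elts Y \<Longrightarrow> X = Y"
    and comprehension:
      "\<exists>Y. elts Y = {x. isset x \<and> sat UNIV (e(n := x)) \<phi>}"
    and empty_set: "isset empty_class"
    and adjoin_set: "isset x \<Longrightarrow> isset y \<Longrightarrow> isset (adjoin x y)"
    and set_induction:
      \<comment> \<open>set formulas: all quantifiers and all parameters range over sets\<close>
      "\<lbrakk>\<And>i. isset (e i);
        sat {x. isset x} (e(n := empty_class)) \<phi>;
        \<And>x y. \<lbrakk>isset x; isset y; sat {x. isset x} (e(n := x)) \<phi>; sat {x. isset x} (e(n := y)) \<phi>\<rbrakk>
          \<Longrightarrow> sat {x. isset x} (e(n := adjoin x y)) \<phi>;
        isset a\<rbrakk> \<Longrightarrow> sat {x. isset x} (e(n := a)) \<phi>"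
    and Thin: "thin X \<Longrightarrow> \<exists>u. isset u \<and> elts X \<subseteq> elts u"
    and Comp:
      "\<lbrakk>thin X; isset u; elts u \<subseteq> (\<Union>t\<in>elts X. elts t)\<rbrakk>
        \<Longrightarrow> \<exists>x. isset x \<and> elts x \<subseteq> elts X \<and> elts u \<subseteq> (\<Union>t\<in>elts x. elts t)"
    and Exp:
      "thin X \<Longrightarrow> \<exists>P. thin P \<and>
        (\<forall>y. isset y \<longrightarrow> (\<exists>p\<in>elts P. elts y \<inter> elts X = elts p \<inter> elts X))"
    and Choice:
      "\<lbrakk>elts D = dom_of R; thin D\<rbrakk>
        \<Longrightarrow> \<exists>F. is_function F \<and> elts F \<subseteq> elts R \<and> dom_of F = dom_of R"
    and Dependent_Choices:
      "\<lbrakk>a \<in> elts A; \<forall>x\<in>elts A. \<exists>y\<in>elts A. rel R x y\<rbrakk>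
        \<Longrightarrow> \<exists>F. is_map F SN (elts A) \<and> app F empty_class = a \<and>
              (\<forall>n\<in>SN. rel R (app F n) (app F (adjoin n n)))"
    and Transfer:
      "(\<And>i. e i \<in> standard) \<Longrightarrow> sat standard e \<phi> \<longleftrightarrow> sat {x. isset x} e \<phi>"

context membership
begin

definition real_number_field :: "'c \<Rightarrow> 'c \<Rightarrow> 'c \<Rightarrow> 'c \<Rightarrow> bool" where
  "real_number_field RR radd rmul rle \<longleftrightarrow>
     thin RR \<and> binop_on radd RR \<and> binop_on rmul RR \<and> is_relation_on rle RR \<and>
     linear_order_on (elts RR) {(x, y). rel rle x y} \<and>
     (\<exists>z u. field \<lparr>carrier = elts RR, mult = app2 rmul, one = u, zero = z, add = app2 radd\<rparr> \<and>
       (\<forall>x\<in>elts RR. \<forall>y\<in>elts RR. rel rle z x \<and> rel rle z y \<longrightarrow> rel rle z (app2 rmul x y))) \<and>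
     (\<forall>x\<in>elts RR. \<forall>y\<in>elts RR. \<forall>w\<in>elts RR.
       rel rle x y \<longrightarrow> rel rle (app2 radd x w) (app2 radd y w)) \<and>
     (\<forall>X. elts X \<subseteq> elts RR \<and> elts X \<noteq> {} \<and> (\<exists>b\<in>elts RR. \<forall>x\<in>elts X. rel rle x b) \<longrightarrow>
       (\<exists>s\<in>elts RR. (\<forall>x\<in>elts X. rel rle x s) \<and>
         (\<forall>b\<in>elts RR. (\<forall>x\<in>elts X. rel rle x b) \<longrightarrow> rel rle s b)))"

definition real_open :: "'c \<Rightarrow> 'c \<Rightarrow> 'c \<Rightarrow> bool" where
  "real_open RR rle V \<longleftrightarrow> elts V \<subseteq> elts RR \<and>
     (\<forall>x\<in>elts V. \<exists>a\<in>elts RR. \<exists>b\<in>elts RR.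
        rel rle a x \<and> a \<noteq> x \<and> rel rle x b \<and> x \<noteq> b \<and>
        (\<forall>y\<in>elts RR. rel rle a y \<and> a \<noteq> y \<and> rel rle y b \<and> y \<noteq> b \<longrightarrow> y \<epsilon> V))"

definition ring_interior :: "'c \<Rightarrow> 'c \<Rightarrow> 'c \<Rightarrow> 'c set" where
  \<comment> \<open>the part of \<open>u\<close> written with a ring accent on top; no algebraic ring is meant\<close>
  "ring_interior Rb rho u = {a \<in> elts u. \<forall>b\<in>elts Rb. rel rho a b \<longrightarrow> b \<epsilon> u}"

definition transversal :: "'c \<Rightarrow> 'c \<Rightarrow> 'c \<Rightarrow> bool" where
  "transversal Rb rho N \<longleftrightarrow> elts N \<subseteq> elts Rb \<and> (\<forall>a\<in>elts Rb. \<exists>!n. n \<epsilon> N \<and> rel rho a n)"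

definition representative :: "'c \<Rightarrow> 'c \<Rightarrow> 'c \<Rightarrow> 'c" where
  "representative rho N a = (THE n. n \<epsilon> N \<and> rel rho a n)"

definition quotient_open :: "'c \<Rightarrow> 'c \<Rightarrow> 'c \<Rightarrow> 'c \<Rightarrow> bool" where
  "quotient_open Rb rho N W \<longleftrightarrow> elts W \<subseteq> elts N \<and>
     (\<forall>a\<in>elts W. \<exists>u. isset u \<and> elts u \<subseteq> elts Rb \<and>
        a \<in> ring_interior Rb rho u \<inter> elts N \<and> ring_interior Rb rho u \<inter> elts N \<subseteq> elts W)"

definition quotient_isomorphism ::
  "'c \<Rightarrow> 'c \<Rightarrow> 'c \<Rightarrow> 'c \<Rightarrow> 'c \<Rightarrow> 'c \<Rightarrow> 'c \<Rightarrow> 'c \<Rightarrow> 'c \<Rightarrow> 'c \<Rightarrow> bool" where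
  "quotient_isomorphism RR radd rmul rle oplus odot Rb rho N F \<longleftrightarrow>
     is_map F (elts N) (elts RR) \<and> bij_betw (app F) (elts N) (elts RR) \<and>
     (\<forall>a\<in>elts N. \<forall>b\<in>elts N.
        app F (representative rho N (app2 oplus a b)) = app2 radd (app F a) (app F b) \<and>
        app F (representative rho N (app2 odot a b)) = app2 rmul (app F a) (app F b)) \<and>
     (\<forall>W V. elts W \<subseteq> elts N \<and> elts V = app F ` elts W \<longrightarrow>
        (quotient_open Rb rho N W \<longleftrightarrow> real_open RR rle V))"

definition hyperfinite_computer_arithmetic ::
  "'c \<Rightarrow> 'c \<Rightarrow> 'c \<Rightarrow> 'c \<Rightarrow> 'c \<Rightarrow> 'c \<Rightarrow> 'c \<Rightarrow> 'c \<Rightarrow> 'c \<Rightarrow> bool" where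
  \<comment> \<open>the operations of the algebra on \<open>r\<close> are themselves sets, not merely classes\<close>
  "hyperfinite_computer_arithmetic RR radd rmul rle r oplus odot Rb rho \<longleftrightarrow>
     isset r \<and> isset oplus \<and> isset odot \<and> binop_on oplus r \<and> binop_on odot r \<and>
     elts Rb \<subseteq> elts r \<and> sigma_class Rb \<and>
     pi_class rho \<and> is_relation_on rho r \<and> equiv (elts r) {(a, b). rel rho a b} \<and>
     (\<forall>u. isset u \<and> elts u \<subseteq> elts Rb \<and> \<not> small u \<longrightarrow>
        (\<exists>a\<in>elts u. \<exists>b\<in>elts u. a \<noteq> b \<and> rel rho a b)) \<and>
     (\<forall>a\<in>elts Rb. \<forall>b\<in>elts Rb. app2 oplus a b \<epsilon> Rb \<and> app2 odot a b \<epsilon> Rb) \<and>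
     (\<forall>a\<in>elts Rb. \<forall>a'\<in>elts Rb. \<forall>b\<in>elts Rb. \<forall>b'\<in>elts Rb.
        rel rho a a' \<and> rel rho b b' \<longrightarrow>
        rel rho (app2 oplus a b) (app2 oplus a' b') \<and>
        rel rho (app2 odot a b) (app2 odot a' b')) \<and>
     (\<exists>N F. thin N \<and> transversal Rb rho N \<and>
        quotient_isomorphism RR radd rmul rle oplus odot Rb rho N F)"

end

end

theory Submission
  imports Defs
begin

text \<open>
  Write \<open>h\<close> for the map from \<open>R\<^sub>b\<close> to \<open>\<real>\<close> induced by the isomorphism and \<open>S\<close> for its kernel. It is not known
  that \<open>R\<^sub>b\<close> contains the zero or the negatives of the ring \<open>r\<close>, so subtraction is only used in \<open>r\<close>.

  The topology gives a set \<open>u\<close> with \<open>S \<subseteq> u \<subseteq> R\<^sub>b\<close>, and the axiom \<open>Comp\<close> allows to shrink it so that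
  \<open>h \<noteq> 1\<close> on \<open>u\<close>. The set \<open>M = {v \<in> u. v u \<subseteq> u}\<close> contains \<open>S\<close>; as \<open>\<real>\<close> is not discrete, \<open>S\<close> is not a set,
  so some \<open>b \<in> M\<close> has \<open>h b \<noteq> 0\<close>. Choose \<open>c \<in> R\<^sub>b\<close> with \<open>h b h c = -1\<close>; then \<open>T v = b v c + v\<close> maps
  \<open>R\<^sub>b\<close> into \<open>S\<close>. The elements of \<open>M\<close> that commute with \<open>b\<close> and act injectively on the kernel of \<open>T\<close>
  form a semigroup containing \<open>b\<close>. It is a set, hence internally finite, and so contains an idempotent \<open>j\<close>;
  since \<open>h j \<noteq> 1\<close>, we get \<open>h j = 0\<close>. The projection \<open>p a = a - j a\<close> commutes with \<open>T\<close>, and \<open>T\<close> is injective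
  on the set \<open>p u\<close>, which it maps into \<open>p S \<subseteq> p u\<close>. By finiteness \<open>T\<close> maps \<open>p u\<close> onto itself, so
  \<open>p b = p s\<close> for some \<open>s \<in> S\<close>. Hence \<open>b + j s = s + j b\<close>, and applying \<open>h\<close> yields \<open>h b = 0\<close>,
  a contradiction.
\<close>

section \<open>Formulas and internally finite sets\<close>

definition Or :: "fm \<Rightarrow> fm \<Rightarrow> fm" where "Or \<phi> \<psi> = Neg (Conj (Neg \<phi>) (Neg \<psi>))"
definition Imp :: "fm \<Rightarrow> fm \<Rightarrow> fm" where "Imp \<phi> \<psi> = Neg (Conj \<phi> (Neg \<psi>))"
definition Iff :: "fm \<Rightarrow> fm \<Rightarrow> fm" where "Iff \<phi> \<psi> = Conj (Imp \<phi> \<psi>) (Imp \<psi> \<phi>)"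
definition Exi :: "nat \<Rightarrow> fm \<Rightarrow> fm" where "Exi i \<phi> = Neg (All i (Neg \<phi>))"
definition Sub :: "nat \<Rightarrow> nat \<Rightarrow> fm" where "Sub i j = All 90 (Imp (Mem 90 i) (Mem 90 j))"
text \<open>Index 91 stands for the singleton and 92 for the unordered pair inside the Kuratowski
  pair. Each is pinned down by its members, since formulas have no symbol for
  \<open>adjoin\<close>.\<close>

definition IsPair :: "nat \<Rightarrow> nat \<Rightarrow> nat \<Rightarrow> fm" where
  "IsPair k i j = Exi 91 (Exi 92 (Conj (All 90 (Iff (Mem 90 91) (Eq 90 i)))
     (Conj (All 90 (Iff (Mem 90 92) (Or (Eq 90 i) (Eq 90 j))))
       (All 90 (Iff (Mem 90 k) (Or (Eq 90 91) (Eq 90 92)))))))"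
definition Rel :: "nat \<Rightarrow> nat \<Rightarrow> nat \<Rightarrow> fm" where
  "Rel f i j = Exi 93 (Conj (IsPair 93 i j) (Mem 93 f))"
definition Op :: "nat \<Rightarrow> nat \<Rightarrow> nat \<Rightarrow> nat \<Rightarrow> fm" where
  "Op f i j k = Exi 94 (Conj (IsPair 94 i j) (Rel f 94 k))"

primrec fv :: "fm \<Rightarrow> nat set" where
  "fv (Mem i j) = {i, j}"
| "fv (Eq i j) = {i, j}"
| "fv (Neg \<phi>) = fv \<phi>"
| "fv (Conj \<phi> \<psi>) = fv \<phi> \<union> fv \<psi>"
| "fv (All i \<phi>) = fv \<phi> - {i}"

lemma finite_fv: "finite (fv \<phi>)"
  by (induction \<phi>) auto

context membership
begin

lemma elts_iff [simp]: "x \<in> elts X \<longleftrightarrow> x \<epsilon> X"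
  by (simp add: elts_def)

lemma isset_mem: "x \<epsilon> X \<Longrightarrow> isset x"
  by (auto simp: isset_def)

abbreviation Sets :: "'c set" where "Sets \<equiv> {x. isset x}"

lemma sat_connectives [simp]:
  "sat D e (Or \<phi> \<psi>) \<longleftrightarrow> sat D e \<phi> \<or> sat D e \<psi>"
  "sat D e (Imp \<phi> \<psi>) \<longleftrightarrow> (sat D e \<phi> \<longrightarrow> sat D e \<psi>)"
  "sat D e (Iff \<phi> \<psi>) \<longleftrightarrow> (sat D e \<phi> \<longleftrightarrow> sat D e \<psi>)"
  "sat D e (Exi i \<phi>) \<longleftrightarrow> (\<exists>x\<in>D. sat D (e(i := x)) \<phi>)"
  by (auto simp: Or_def Imp_def Iff_def Exi_def)

text \<open>Coincidence of assignments on the free variables; it lets fresh variables carry extra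
  parameters without affecting \<open>\<phi>\<close>.\<close>

lemma sat_cong_fv: "(\<And>i. i \<in> fv \<phi> \<Longrightarrow> e i = e' i) \<Longrightarrow> sat D e \<phi> \<longleftrightarrow> sat D e' \<phi>"
proof (induction \<phi> arbitrary: e e')
  case (Neg \<phi>)
  then show ?case by (metis fv.simps(3) sat.simps(3))
next
  case (Conj \<phi>1 \<phi>2)
  then show ?case by (metis UnCI fv.simps(4) sat.simps(4))
next
  case (All i \<phi>)
  have "sat D (e(i := x)) \<phi> \<longleftrightarrow> sat D (e'(i := x)) \<phi>" for x
    using All.prems by (intro All.IH) auto
  then show ?case by simp
qed auto

text \<open>Parameters are put at the indices \<open>0, 1, \<dots>\<close>; the variable of comprehension is \<open>50\<close>, and
  indices from \<open>90\<close> on are reserved for the bound variables of the formula macros.\<close>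

definition env :: "'c list \<Rightarrow> nat \<Rightarrow> 'c" where
  "env ps i = (if i < length ps then ps ! i else empty_class)"

lemma env_numeral [simp]:
  "env (p # ps) 0 = p"
  "env (p # ps) (Suc i) = env ps i"
  "env (p # ps) 1 = env ps 0"
  "env (p # ps) (numeral k) = env ps (pred_numeral k)"
  by (auto simp: env_def numeral_eq_Suc)

lemma sat_Sub [simp]:
  "i < 90 \<Longrightarrow> j < 90 \<Longrightarrow> sat Sets e (Sub i j) \<longleftrightarrow> elts (e i) \<subseteq> elts (e j)"
  by (auto simp: Sub_def isset_mem)

end

context THS
begin

section \<open>Extensionality, adjunction and ordered pairs\<close>

lemma ext_iff: "X = Y \<longleftrightarrow> (\<forall>x. x \<epsilon> X \<longleftrightarrow> x \<epsilon> Y)"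
  using extensionality[of X Y] by (metis elts_iff subsetI subset_antisym)

text \<open>Extensionality makes the description unique, so it suffices that comprehension supplies
  one class with the right members.\<close>

lemma the_elts: "\<exists>Y. elts Y = A \<Longrightarrow> elts (THE w. elts w = A) = A"
  using extensionality by (metis (mono_tags, lifting) theI)

lemma mem_empty [simp]: "\<not> x \<epsilon> empty_class"
proof -
  have "elts empty_class = {}"
    unfolding empty_class_def
    by (rule the_elts) (use comprehension[of e n "Neg (Eq n n)" for e n] in auto)
  then show ?thesis by auto
qed

lemma mem_adjoin [simp]:
  assumes "isset y" shows "z \<epsilon> adjoin x y \<longleftrightarrow> z = y \<or> z \<epsilon> x"
proof -
  have "elts (adjoin x y) = insert y (elts x)"
    unfolding adjoin_def
  proof (rule the_elts)
    obtain Y where Y: "elts Y = {z. isset z \<and> sat UNIV ((env [x, y])(50 := z)) (Or (Eq 50 1) (Mem 50 0))}"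
      using comprehension by blast
    have "elts Y = insert y (elts x)"
      unfolding Y using assms by (auto simp: isset_mem)
    then show "\<exists>Y. elts Y = insert y (elts x)" ..
  qed
  then show ?thesis by (metis elts_iff insert_iff)
qed

lemmas set_intros [simp] = empty_set adjoin_set

lemma isset_env [simp]: "list_all isset ps \<Longrightarrow> isset (env ps i)"
  by (auto simp: env_def list_all_length)

lemma isset_pair [simp]: "isset a \<Longrightarrow> isset b \<Longrightarrow> isset (pair a b)"
  by (simp add: pair_def)

lemma mem_pair:
  assumes "isset a" "isset b"
  shows "x \<epsilon> pair a b \<longleftrightarrow> x = adjoin empty_class a \<or> x = adjoin (adjoin empty_class a) b"
  using assms by (auto simp: pair_def)

lemma pair_inject [simp]:
  assumes "isset a" "isset b" "isset c" "isset d"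
  shows "pair a b = pair c d \<longleftrightarrow> a = c \<and> b = d"
proof
  have sing: "adjoin empty_class x = adjoin empty_class y \<longleftrightarrow> x = y" if "isset x" "isset y" for x y
    using that by (metis mem_adjoin mem_empty)
  assume eq: "pair a b = pair c d"
  have x: "\<And>x. (x = adjoin empty_class a \<or> x = adjoin (adjoin empty_class a) b) \<longleftrightarrow>
     (x = adjoin empty_class c \<or> x = adjoin (adjoin empty_class c) d)"
    using eq assms by (metis mem_pair)
  have "a = c"
    using x[of "adjoin empty_class a"] x[of "adjoin empty_class c"] assms sing
    by (metis mem_adjoin mem_empty)
  moreover have "b = d"
    using x[of "adjoin (adjoin empty_class a) b"] x[of "adjoin (adjoin empty_class c) d"]
      \<open>a = c\<close> assms by (metis mem_adjoin mem_empty)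
  ultimately show "a = c \<and> b = d" ..
qed auto

text \<open>The singleton and the unordered pair are again sets, and all members of a class are
  sets; so relativizing the quantifiers to sets does not change the meaning.\<close>

lemma sat_IsPair [simp]:
  assumes "isset (e i)" "isset (e j)" "{i, j, k} \<inter> {90, 91, 92} = {}"
  shows "sat Sets e (IsPair k i j) \<longleftrightarrow> e k = pair (e i) (e j)"
proof -
  let ?s = "adjoin empty_class (e i)" and ?d = "adjoin (adjoin empty_class (e i)) (e j)"
  have s: "(\<forall>y. isset y \<longrightarrow> (y \<epsilon> x \<longleftrightarrow> y = e i)) \<longleftrightarrow> x = ?s" for x
    using assms by (simp add: ext_iff[of x]) (metis isset_mem)
  have d: "(\<forall>y. isset y \<longrightarrow> (y \<epsilon> x \<longleftrightarrow> y = e i \<or> y = e j)) \<longleftrightarrow> x = ?d" for x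
    using assms by (simp add: ext_iff[of x]) (metis isset_mem)
  have p: "(\<forall>y. isset y \<longrightarrow> (y \<epsilon> x \<longleftrightarrow> y = ?s \<or> y = ?d)) \<longleftrightarrow> x = pair (e i) (e j)" for x
    using assms by (simp add: ext_iff[of x] mem_pair) (metis isset_mem set_intros)
  have ne: "i \<noteq> 90" "i \<noteq> 91" "i \<noteq> 92" "j \<noteq> 90" "j \<noteq> 91" "j \<noteq> 92" "k \<noteq> 90" "k \<noteq> 91" "k \<noteq> 92"
    using assms by auto
  have set: "isset ?s" "isset ?d" using assms by auto
  show ?thesis
    using ne ne[symmetric] set by (simp add: IsPair_def s d p)
qed

lemma sat_Rel [simp]:
  assumes "isset (e i)" "isset (e j)" "{i, j, f} \<inter> {90, 91, 92, 93} = {}"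
  shows "sat Sets e (Rel f i j) \<longleftrightarrow> pair (e i) (e j) \<epsilon> e f"
  using assms by (auto simp: Rel_def)

lemma sat_Op [simp]:
  assumes "isset (e i)" "isset (e j)" "isset (e k)" "{i, j, k, f} \<inter> {90, 91, 92, 93, 94} = {}"
  shows "sat Sets e (Op f i j k) \<longleftrightarrow> pair (pair (e i) (e j)) (e k) \<epsilon> e f"
  using assms by (auto simp: Op_def)

section \<open>Separation and induction for set formulas\<close>

text \<open>Induction on \<open>a\<close>: when \<open>y\<close> is adjoined, the separated set
  either gains \<open>y\<close> or stays the same. The fresh variables \<open>k\<close> and
  \<open>m\<close> hold \<open>a\<close> and the separated set, so that the claim itself becomes a
  set formula.\<close>

lemma separation_fm:
  assumes e: "\<And>i. isset (e i)" and "isset a"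
  shows "\<exists>b. isset b \<and> elts b = {x \<in> elts a. sat Sets (e(n := x)) \<phi>}"
proof -
  obtain k where k: "k \<notin> insert n (fv \<phi>)"
    using ex_new_if_finite[of "insert n (fv \<phi>)"] finite_fv[of \<phi>] by auto
  obtain m where m: "m \<notin> insert k (insert n (fv \<phi>))"
    using ex_new_if_finite[of "insert k (insert n (fv \<phi>))"] finite_fv[of \<phi>] by auto
  let ?P = "\<lambda>a. \<exists>b. isset b \<and> elts b = {x \<in> elts a. sat Sets (e(n := x)) \<phi>}"
  let ?\<psi> = "Exi m (All n (Iff (Mem n m) (Conj (Mem n k) \<phi>)))"
  have indep: "sat Sets (e(k := a, m := b, n := x)) \<phi> \<longleftrightarrow> sat Sets (e(n := x)) \<phi>" for a b x
    using k m by (intro sat_cong_fv) auto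
  have ne: "k \<noteq> n" "m \<noteq> k" "m \<noteq> n" "n \<noteq> k" "k \<noteq> m" "n \<noteq> m" using k m by auto
  have sat: "sat Sets (e(k := a)) ?\<psi> \<longleftrightarrow> ?P a" for a
  proof -
    have "(elts b = {x \<in> elts a. sat Sets (e(n := x)) \<phi>}) \<longleftrightarrow>
        (\<forall>x. isset x \<longrightarrow> (x \<epsilon> b \<longleftrightarrow> x \<epsilon> a \<and> sat Sets (e(n := x)) \<phi>))" for b
      unfolding set_eq_iff elts_iff mem_Collect_eq by (metis isset_mem)
    then show ?thesis using ne by (simp add: indep)
  qed
  have "sat Sets (e(k := a)) ?\<psi>"
  proof (rule set_induction[where e = e])
    show "sat Sets (e(k := empty_class)) ?\<psi>"
      unfolding sat by (intro exI[of _ empty_class]) auto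
  next
    fix x y assume xy: "isset x" "isset y" "sat Sets (e(k := x)) ?\<psi>"
    from xy(3)[unfolded sat] obtain b where b: "isset b" "elts b = {z \<in> elts x. sat Sets (e(n := z)) \<phi>}"
      by (elim exE conjE)
    show "sat Sets (e(k := adjoin x y)) ?\<psi>"
      unfolding sat
    proof (cases "sat Sets (e(n := y)) \<phi>")
      case True
      then show "?P (adjoin x y)"
        using b xy(1,2) by (intro exI[of _ "adjoin b y"]) (auto simp: set_eq_iff)
    next
      case False
      then show "?P (adjoin x y)"
        using b xy(1,2) by (intro exI[of _ b]) (auto simp: set_eq_iff)
    qed
  qed (use assms in auto)
  then show ?thesis unfolding sat .
qed

lemma separation:
  assumes "list_all isset ps" "isset a"
  obtains b where "isset b"
    "\<And>x. x \<epsilon> b \<longleftrightarrow> x \<epsilon> a \<and> sat Sets ((env ps)(50 := x)) \<phi>"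
proof -
  obtain b where "isset b" "elts b = {x \<in> elts a. sat Sets ((env ps)(50 := x)) \<phi>}"
    using separation_fm[of "env ps" a 50 \<phi>] assms by auto
  then show ?thesis by (intro that[of b]) (auto simp: set_eq_iff)
qed

text \<open>The induction axiom with a step that assumes nothing of the adjoined element
  \<open>y\<close>. The predicate has to agree with a formula on sets only, the parameters being
  listed in \<open>ps\<close>.\<close>

lemma set_induct:
  assumes "isset a" and "list_all isset ps"
    and "\<And>x. isset x \<Longrightarrow> P x \<longleftrightarrow> sat Sets ((env ps)(50 := x)) \<phi>"
    and "P empty_class"
    and "\<And>x y. isset x \<Longrightarrow> isset y \<Longrightarrow> P x \<Longrightarrow> P (adjoin x y)"
  shows "P a"
proof -
  have "sat Sets ((env ps)(50 := a)) \<phi>"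
  proof (rule set_induction[where e = "env ps" and n = 50 and \<phi> = \<phi> and a = a])
    show "isset (env ps i)" for i using assms(2) by simp
    show "sat Sets ((env ps)(50 := empty_class)) \<phi>" using assms(3)[OF empty_set] assms(4) by simp
    show "sat Sets ((env ps)(50 := adjoin x y)) \<phi>"
      if "isset x" "isset y" "sat Sets ((env ps)(50 := x)) \<phi>" for x y
    proof -
      have "P (adjoin x y)" using assms(3)[OF that(1)] that(3) by (intro assms(5) that(1,2)) simp
      then show ?thesis using assms(3)[OF adjoin_set[OF that(1,2)]] by simp
    qed
  qed (fact assms(1))
  then show ?thesis using assms(3)[OF assms(1)] by simp
qed

section \<open>Unions, power sets, minimal members and products\<close>

lemma union_set:
  assumes "isset a" "isset b"
  obtains c where "isset c" "\<And>x. x \<epsilon> c \<longleftrightarrow> x \<epsilon> a \<or> x \<epsilon> b"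
proof -
  have "\<exists>c. isset c \<and> (\<forall>x. isset x \<longrightarrow> (x \<epsilon> c \<longleftrightarrow> x \<epsilon> a \<or> x \<epsilon> b))" (is "?P a")
  proof (rule set_induct[where P = ?P and ps = "[b]" and
      \<phi> = "Exi 51 (All 52 (Iff (Mem 52 51) (Or (Mem 52 50) (Mem 52 0))))"])
    fix x y assume xy: "isset x" "isset y" "?P x"
    then obtain c where "isset c" "\<forall>z. isset z \<longrightarrow> (z \<epsilon> c \<longleftrightarrow> z \<epsilon> x \<or> z \<epsilon> b)" by blast
    then show "?P (adjoin x y)"
      using xy by (intro exI[of _ "adjoin c y"]) auto
  qed (use assms in auto)
  then show ?thesis using that by (metis isset_mem)
qed

lemma Union_set:
  assumes "isset a"
  obtains c where "isset c" "\<And>x. x \<epsilon> c \<longleftrightarrow> (\<exists>t. t \<epsilon> a \<and> x \<epsilon> t)"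
proof -
  have "\<exists>c. isset c \<and> (\<forall>x. isset x \<longrightarrow> (x \<epsilon> c \<longleftrightarrow> (\<exists>t. isset t \<and> t \<epsilon> a \<and> x \<epsilon> t)))" (is "?P a")
  proof (rule set_induct[where P = ?P and ps = "[]" and
      \<phi> = "Exi 51 (All 52 (Iff (Mem 52 51) (Exi 53 (Conj (Mem 53 50) (Mem 52 53)))))"])
    fix x y assume xy: "isset x" "isset y" "?P x"
    then obtain c where c: "isset c" "\<forall>z. isset z \<longrightarrow> (z \<epsilon> c \<longleftrightarrow> (\<exists>t. isset t \<and> t \<epsilon> x \<and> z \<epsilon> t))"
      by blast
    obtain d where "isset d" "\<And>z. z \<epsilon> d \<longleftrightarrow> z \<epsilon> c \<or> z \<epsilon> y"
      using union_set[OF c(1) xy(2)] by blast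
    then show "?P (adjoin x y)"
      using xy c by (intro exI[of _ d]) auto
  qed (use assms in \<open>auto intro!: exI[of _ empty_class]\<close>)
  then show ?thesis using that by (metis isset_mem)
qed

text \<open>Generalising over a lower bound \<open>d\<close> of the subsets makes the induction step of the next two
  proofs a case distinction on \<open>d\<close> and \<open>d \<union> {y}\<close>, with no need for replacement.\<close>

lemma powerset:
  assumes "isset a"
  obtains p where "isset p" "\<And>x. x \<epsilon> p \<longleftrightarrow> isset x \<and> elts x \<subseteq> elts a"
proof -
  let ?R = "\<lambda>a d p. \<forall>x. isset x \<longrightarrow> (x \<epsilon> p \<longleftrightarrow> elts d \<subseteq> elts x \<and> (\<forall>z. isset z \<longrightarrow> z \<epsilon> x \<longrightarrow> z \<epsilon> a \<or> z \<epsilon> d))"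
  have "\<forall>d. isset d \<longrightarrow> (\<exists>p. isset p \<and> ?R a d p)" (is "?P a")
  proof (rule set_induct[where P = ?P and ps = "[]" and
      \<phi> = "All 51 (Exi 52 (All 53 (Iff (Mem 53 52) (Conj (Sub 51 53)
         (All 54 (Imp (Mem 54 53) (Or (Mem 54 50) (Mem 54 51))))))))"])
    show "?P empty_class"
    proof (intro allI impI)
      fix d assume "isset d"
      then have "?R empty_class d (adjoin empty_class d)"
        by (auto simp: ext_iff[of _ d] isset_mem)
      then show "\<exists>p. isset p \<and> ?R empty_class d p"
        using \<open>isset d\<close> by (intro exI[of _ "adjoin empty_class d"]) simp
    qed
  next
    fix x y assume xy: "isset x" "isset y" "?P x"
    show "?P (adjoin x y)"
    proof (intro allI impI)
      fix d assume d: "isset d"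
      \<comment> \<open>\<open>p\<close> holds the sets between \<open>d\<close> and
        \<open>x \<union> d\<close>, and \<open>q\<close> those between
        \<open>d \<union> {y}\<close> and \<open>x \<union> d \<union> {y}\<close>. A set between
        \<open>d\<close> and \<open>x \<union> {y} \<union> d\<close> is of the first kind if it
        omits \<open>y\<close> and of the second if it contains \<open>y\<close>.\<close>
      obtain p where p: "isset p" "?R x d p" using xy(3)[THEN spec, THEN mp, OF d] by (elim exE conjE)
      obtain q where q: "isset q" "?R x (adjoin d y) q"
        using xy(3)[THEN spec, THEN mp, OF adjoin_set[OF d xy(2)]] by (elim exE conjE)
      obtain c where c: "isset c" "\<And>z. z \<epsilon> c \<longleftrightarrow> z \<epsilon> p \<or> z \<epsilon> q"
        using union_set[OF p(1) q(1)] by blast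
      have "?R (adjoin x y) d c"
      proof (intro allI impI)
        fix v assume v: "isset v"
        have "v \<epsilon> c \<longleftrightarrow> v \<epsilon> p \<or> v \<epsilon> q" by (rule c)
        also have "\<dots> \<longleftrightarrow> elts d \<subseteq> elts v \<and> (\<forall>z. isset z \<longrightarrow> z \<epsilon> v \<longrightarrow> z \<epsilon> adjoin x y \<or> z \<epsilon> d)"
          using p(2)[THEN spec, THEN mp, OF v] q(2)[THEN spec, THEN mp, OF v] xy(2)
          by (simp add: subset_iff) blast
        finally show "v \<epsilon> c \<longleftrightarrow> elts d \<subseteq> elts v \<and> (\<forall>z. isset z \<longrightarrow> z \<epsilon> v \<longrightarrow> z \<epsilon> adjoin x y \<or> z \<epsilon> d)" .
      qed
      then show "\<exists>p. isset p \<and> ?R (adjoin x y) d p" using c(1) by blast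
    qed
  qed (use assms in auto)
  from this[THEN spec, THEN mp, OF empty_set] obtain p where p: "isset p" "?R a empty_class p"
    by (elim exE conjE)
  have "x \<epsilon> p \<longleftrightarrow> isset x \<and> elts x \<subseteq> elts a" for x
    using p(2)[THEN spec, of x] isset_mem[of _ x] isset_mem[of x p] by (auto simp: subset_iff)
  then show ?thesis using that p(1) by blast
qed

lemma minimal_member:
  assumes "isset F" "v \<epsilon> F"
  obtains u where "u \<epsilon> F" "elts u \<subseteq> elts v" "\<And>u'. u' \<epsilon> F \<Longrightarrow> elts u' \<subseteq> elts u \<Longrightarrow> u' = u"
proof -
  let ?R = "\<lambda>a d u. isset u \<and> u \<epsilon> F \<and> elts d \<subseteq> elts u \<and> (\<forall>z. isset z \<longrightarrow> z \<epsilon> u \<longrightarrow> z \<epsilon> a \<or> z \<epsilon> d)"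
  have "\<forall>d. isset d \<longrightarrow> (\<exists>u. ?R v d u) \<longrightarrow>
     (\<exists>u. ?R v d u \<and> (\<forall>u'. isset u' \<longrightarrow> u' \<epsilon> F \<and> elts d \<subseteq> elts u' \<and> elts u' \<subseteq> elts u \<longrightarrow> u' = u))" (is "?P v")
  proof (rule set_induct[where P = ?P and ps = "[F]" and
      \<phi> = "let A = (\<lambda>n. Conj (Mem n 0) (Conj (Sub 51 n) (All 54 (Imp (Mem 54 n) (Or (Mem 54 50) (Mem 54 51)))))) in
       All 51 (Imp (Exi 52 (A 52)) (Exi 52 (Conj (A 52)
         (All 53 (Imp (Conj (Mem 53 0) (Conj (Sub 51 53) (Sub 53 52))) (Eq 53 52))))))"])
    show "?P empty_class"
    proof (intro allI impI)
      fix d assume "isset d" "\<exists>u. ?R empty_class d u"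
      then obtain u where u: "?R empty_class d u" by blast
      then have "u = d" by (auto simp: ext_iff[of _ d] isset_mem)
      then show "\<exists>u. ?R empty_class d u \<and> (\<forall>u'. isset u' \<longrightarrow> u' \<epsilon> F \<and> elts d \<subseteq> elts u' \<and> elts u' \<subseteq> elts u \<longrightarrow> u' = u)"
        using u by (intro exI[of _ u]) (auto simp: extensionality subset_antisym)
    qed
  next
    fix x y assume xy: "isset x" "isset y" "?P x"
    show "?P (adjoin x y)"
    proof (intro allI impI)
      fix d assume d: "isset d" and ex: "\<exists>u. ?R (adjoin x y) d u"
      let ?min = "\<lambda>d u. \<forall>u'. isset u' \<longrightarrow> u' \<epsilon> F \<and> elts d \<subseteq> elts u' \<and> elts u' \<subseteq> elts u \<longrightarrow> u' = u"
      show "\<exists>u. ?R (adjoin x y) d u \<and> ?min d u"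
      proof (cases "\<exists>u. ?R x d u")
        case True
        from xy(3)[THEN spec, THEN mp, THEN mp, OF d True] obtain u where u: "?R x d u" "?min d u"
          by blast 
        have "?R (adjoin x y) d u" using u(1) xy(2) by simp
        then show ?thesis using u(2) by blast
      next
        case False
        let ?d = "adjoin d y"
        \<comment> \<open>No member of \<open>F\<close> lies between \<open>d\<close> and
          \<open>x \<union> d\<close>, so every candidate contains \<open>y\<close>; minimality
          above \<open>d \<union> {y}\<close> is then minimality above \<open>d\<close>.\<close>
        have sub: "?R x ?d u" if "?R (adjoin x y) d u" for u
          using that False xy by (auto simp: subset_iff)
        have "isset ?d" using d xy by simp
        moreover have "\<exists>u. ?R x ?d u" using sub ex by blast
        ultimately obtain u where u: "?R x ?d u" "?min ?d u"
          using xy(3)[THEN spec, THEN mp, THEN mp, of ?d] by blast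
        have "?R (adjoin x y) d u" using u(1) xy by (auto simp: subset_iff)
        moreover have "?min d u"
        proof (intro allI impI)
          fix u' assume u': "isset u'" "u' \<epsilon> F \<and> elts d \<subseteq> elts u' \<and> elts u' \<subseteq> elts u"
          then have "?R (adjoin x y) d u'" using u(1) xy by (auto simp: subset_iff)
          then have "elts ?d \<subseteq> elts u'" using sub by blast
          then show "u' = u" using u(2) u' by blast
        qed
        ultimately show ?thesis by blast
      qed
    qed
  qed (use assms in \<open>auto simp: Let_def isset_mem\<close>)
  from this[THEN spec, THEN mp, THEN mp, OF empty_set]
  obtain u where u: "?R v empty_class u"
    "\<forall>u'. isset u' \<longrightarrow> u' \<epsilon> F \<and> elts empty_class \<subseteq> elts u' \<and> elts u' \<subseteq> elts u \<longrightarrow> u' = u"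
    using assms isset_mem[of v F] by (metis elts_iff mem_empty subsetI)
  show ?thesis
  proof (rule that[of u])
    show "u \<epsilon> F" "elts u \<subseteq> elts v" using u(1) isset_mem[of _ u] by auto
    show "u' = u" if "u' \<epsilon> F" "elts u' \<subseteq> elts u" for u'
      using u(2) that isset_mem[of u' F] by auto
  qed
qed

text \<open>All the pairs lie in the double power set of the union of \<open>a\<close> and
  \<open>b\<close>, from which separation cuts out the product.\<close>

lemma product_set:
  assumes "isset a" "isset b"
  obtains c where "isset c" "\<And>p. p \<epsilon> c \<longleftrightarrow> (\<exists>x y. x \<epsilon> a \<and> y \<epsilon> b \<and> p = pair x y)"
proof -
  obtain w where w: "isset w" "\<And>x. x \<epsilon> w \<longleftrightarrow> x \<epsilon> a \<or> x \<epsilon> b"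
    using union_set[OF assms] by blast
  obtain p where p: "isset p" "\<And>x. x \<epsilon> p \<longleftrightarrow> isset x \<and> elts x \<subseteq> elts w"
    using powerset[OF w(1)] by blast
  obtain q where q: "isset q" "\<And>x. x \<epsilon> q \<longleftrightarrow> isset x \<and> elts x \<subseteq> elts p"
    using powerset[OF p(1)] by blast
  obtain c where c: "isset c" "\<And>x. x \<epsilon> c \<longleftrightarrow> x \<epsilon> q \<and> sat Sets ((env [a, b])(50 := x))
      (Exi 51 (Exi 52 (Conj (Mem 51 0) (Conj (Mem 52 1) (IsPair 50 51 52)))))"
    by (rule separation[of "[a, b]" q], use assms q in simp, use assms q in simp, blast)
  have "pair x y \<epsilon> q" if "x \<epsilon> a" "y \<epsilon> b" for x y
    using that isset_mem[OF that(1)] isset_mem[OF that(2)]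
    by (auto simp: q p w mem_pair subset_iff)
  then have "p \<epsilon> c \<longleftrightarrow> (\<exists>x y. x \<epsilon> a \<and> y \<epsilon> b \<and> p = pair x y)" for p
    by (simp add: c(2) Bex_def) (metis isset_mem)
  then show ?thesis using that c(1) by blast
qed

section \<open>Finiteness arguments: idempotents and injective self-maps\<close>

text \<open>Ties a HOL operation to a class \<open>m\<close> coding its graph, so that formulas can
  speak of \<open>f\<close> through the parameter \<open>m\<close>. Only arguments from
  \<open>A\<close> are constrained.\<close>

definition graph2 :: "'a \<Rightarrow> ('a \<Rightarrow> 'a \<Rightarrow> 'a) \<Rightarrow> 'a set \<Rightarrow> bool" where
  "graph2 m f A \<longleftrightarrow> (\<forall>x\<in>A. \<forall>y\<in>A. \<forall>v. isset v \<longrightarrow> (pair (pair x y) v \<epsilon> m \<longleftrightarrow> v = f x y))"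

text \<open>A minimal subsemigroup \<open>S\<close> satisfies \<open>S s = S\<close> and \<open>{t \<in> S. t s = s} = S\<close> for each of its elements \<open>s\<close>.\<close>

lemma idempotent_exists:
  assumes U: "isset U" "a \<epsilon> U" and m: "isset m" "graph2 m f (elts U)"
    and closed: "\<And>x y. x \<epsilon> U \<Longrightarrow> y \<epsilon> U \<Longrightarrow> f x y \<epsilon> U"
    and assoc: "\<And>x y z. x \<epsilon> U \<Longrightarrow> y \<epsilon> U \<Longrightarrow> z \<epsilon> U \<Longrightarrow> f (f x y) z = f x (f y z)"
  obtains j where "j \<epsilon> U" "f j j = j"
proof -
  have g: "pair (pair x y) v \<epsilon> m \<longleftrightarrow> v = f x y" if "x \<epsilon> U" "y \<epsilon> U" "isset v" for x y v
    using m(2) that by (auto simp: graph2_def)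
  obtain P where P: "isset P" "\<And>x. x \<epsilon> P \<longleftrightarrow> isset x \<and> elts x \<subseteq> elts U"
    using powerset[OF U(1)] by blast
  obtain F where F: "isset F" "\<And>S. S \<epsilon> F \<longleftrightarrow> S \<epsilon> P \<and> sat Sets ((env [m])(50 := S))
     (Conj (Exi 51 (Mem 51 50)) (All 51 (All 52 (All 53
       (Imp (Conj (Mem 51 50) (Conj (Mem 52 50) (Op 0 51 52 53))) (Mem 53 50))))))"
    by (rule separation[of "[m]" P], use m P in simp, use m P in simp, blast)
  have F_iff: "S \<epsilon> F \<longleftrightarrow> isset S \<and> elts S \<subseteq> elts U \<and> (\<exists>x. x \<epsilon> S) \<and>
      (\<forall>x y. x \<epsilon> S \<longrightarrow> y \<epsilon> S \<longrightarrow> f x y \<epsilon> S)" for S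
  proof (cases "isset S \<and> elts S \<subseteq> elts U")
    case True
    then have "x \<epsilon> U" if "x \<epsilon> S" for x using that by auto
    then show ?thesis using True
      by (simp add: F(2) P Bex_def) (metis isset_mem g closed)
  qed (auto simp: F(2) P)
  have "U \<epsilon> F" using U closed by (auto simp: F_iff)
  then obtain S where S: "S \<epsilon> F" and min: "\<And>S'. S' \<epsilon> F \<Longrightarrow> elts S' \<subseteq> elts S \<Longrightarrow> S' = S"
    using minimal_member[OF F(1)] by metis
  have SU: "x \<epsilon> U" "isset x" if "x \<epsilon> S" for x using S that by (auto simp: F_iff isset_mem)
  have "isset S" using S by (simp add: F_iff)
  obtain s where s: "s \<epsilon> S" using S by (auto simp: F_iff)
  obtain A where A: "isset A" "\<And>x. x \<epsilon> A \<longleftrightarrow> x \<epsilon> S \<and> sat Sets ((env [m, S, s])(50 := x))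
     (Exi 51 (Conj (Mem 51 1) (Op 0 51 2 50)))"
    by (rule separation[of "[m, S, s]" S], use m \<open>isset S\<close> SU s in simp, use m \<open>isset S\<close> SU s in simp, blast)
  have A_iff: "x \<epsilon> A \<longleftrightarrow> x \<epsilon> S \<and> (\<exists>t. t \<epsilon> S \<and> x = f t s)" for x
  proof (cases "x \<epsilon> S")
    case True
    then show ?thesis using SU s by (simp add: A(2) Bex_def) (metis g)
  qed (simp add: A(2))
  have cl: "f x y \<epsilon> S" if "x \<epsilon> S" "y \<epsilon> S" for x y using S that by (auto simp: F_iff)
  have "A \<epsilon> F"
    unfolding F_iff
  proof (intro conjI allI impI)
    show "isset A" by fact
    show "elts A \<subseteq> elts U" using SU by (auto simp: A_iff)
    show "\<exists>x. x \<epsilon> A" using cl s A_iff by blast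
    fix x y assume "x \<epsilon> A" "y \<epsilon> A"
    then obtain t u where "t \<epsilon> S" "x = f t s" "u \<epsilon> S" "y = f u s" by (auto simp: A_iff)
    then have "f x y = f (f (f t s) u) s" using assoc cl s SU by auto
    moreover have "f (f t s) u \<epsilon> S" using \<open>t \<epsilon> S\<close> \<open>u \<epsilon> S\<close> cl s by blast
    ultimately show "f x y \<epsilon> A" using cl s by (metis A_iff)
  qed
  then have "A = S" by (rule min) (auto simp: A_iff)
  \<comment> \<open>This \<open>t\<close> is what makes the stabilizer \<open>B\<close> of
    \<open>s\<close> nonempty.\<close>
  then obtain t where t: "t \<epsilon> S" "s = f t s" using s A_iff by blast
  obtain B where B: "isset B" "\<And>x. x \<epsilon> B \<longleftrightarrow> x \<epsilon> S \<and> sat Sets ((env [m, s])(50 := x)) (Op 0 50 1 1)"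
    by (rule separation[of "[m, s]" S], use m \<open>isset S\<close> SU s in simp, use m \<open>isset S\<close> SU s in simp, blast)
  have B_iff: "x \<epsilon> B \<longleftrightarrow> x \<epsilon> S \<and> f x s = s" for x
    using SU s g by (cases "x \<epsilon> S") (auto simp: B(2))
  have "B \<epsilon> F"
    unfolding F_iff
  proof (intro conjI allI impI)
    show "isset B" by fact
    show "elts B \<subseteq> elts U" using SU by (auto simp: B_iff)
    show "\<exists>x. x \<epsilon> B" using t by (auto simp: B_iff)
    show "f x y \<epsilon> B" if "x \<epsilon> B" "y \<epsilon> B" for x y
      using that cl s assoc SU by (auto simp: B_iff)
  qed
  then have "B = S" by (rule min) (auto simp: B_iff)
  then have "f s s = s" using s B_iff by blast
  then show ?thesis using that SU s by blast
qed

text \<open>If \<open>f\<close> were injective but not surjective, a minimal \<open>B\<close> with \<open>f ` B \<subset> B\<close> would be contradicted by \<open>f ` B\<close>.\<close>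

lemma inj_endo_surj:
  assumes X: "isset X" and g: "isset g" "\<And>x y. x \<epsilon> X \<Longrightarrow> y \<epsilon> X \<Longrightarrow> pair x y \<epsilon> g \<longleftrightarrow> y = f x"
    and into: "\<And>x. x \<epsilon> X \<Longrightarrow> f x \<epsilon> X" and inj: "inj_on f (elts X)"
    and y: "y \<epsilon> X"
  shows "\<exists>x. x \<epsilon> X \<and> f x = y"
proof (rule ccontr)
  assume neg: "\<not> ?thesis"
  obtain P where P: "isset P" "\<And>x. x \<epsilon> P \<longleftrightarrow> isset x \<and> elts x \<subseteq> elts X"
    using powerset[OF X] by blast
  \<comment> \<open>\<open>F\<close> collects the subsets closed under \<open>f\<close> that have a
    point outside their own image.\<close>
  obtain F where F: "isset F" "\<And>B. B \<epsilon> F \<longleftrightarrow> B \<epsilon> P \<and> sat Sets ((env [g])(50 := B))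
     (Conj (All 51 (Imp (Mem 51 50) (Exi 52 (Conj (Mem 52 50) (Rel 0 51 52)))))
       (Exi 52 (Conj (Mem 52 50) (All 51 (Imp (Mem 51 50) (Neg (Rel 0 51 52)))))))"
    by (rule separation[of "[g]" P], use g P in simp, use g P in simp, blast)
  have F_iff: "B \<epsilon> F \<longleftrightarrow> isset B \<and> elts B \<subseteq> elts X \<and> (\<forall>x. x \<epsilon> B \<longrightarrow> f x \<epsilon> B) \<and>
      (\<exists>y. y \<epsilon> B \<and> (\<forall>x. x \<epsilon> B \<longrightarrow> y \<noteq> f x))" for B
  proof (cases "isset B \<and> elts B \<subseteq> elts X")
    case True
    then have BX: "x \<epsilon> X" "isset x" if "x \<epsilon> B" for x using that isset_mem by auto
    have 1: "(isset x \<longrightarrow> x \<epsilon> B \<longrightarrow> (\<exists>y. isset y \<and> y \<epsilon> B \<and> pair x y \<epsilon> g)) \<longleftrightarrow> (x \<epsilon> B \<longrightarrow> f x \<epsilon> B)" for x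
      using BX g(2) into by metis
    have 2: "(isset y \<and> y \<epsilon> B \<and> (\<forall>x. isset x \<longrightarrow> x \<epsilon> B \<longrightarrow> \<not> pair x y \<epsilon> g)) \<longleftrightarrow>
        (y \<epsilon> B \<and> (\<forall>x. x \<epsilon> B \<longrightarrow> y \<noteq> f x))" for y
      using BX g(2) by metis
    show ?thesis using True by (simp add: F(2) P Bex_def 1 2)
  qed (auto simp: F(2) P)
  have "X \<epsilon> F" using X into neg y by (auto simp: F_iff)
  then obtain B where B: "B \<epsilon> F" and min: "\<And>B'. B' \<epsilon> F \<Longrightarrow> elts B' \<subseteq> elts B \<Longrightarrow> B' = B"
    using minimal_member[OF F(1)] by metis
  have BX: "x \<epsilon> X" "isset x" if "x \<epsilon> B" for x using B that by (auto simp: F_iff isset_mem)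
  have "isset B" and into_B: "\<And>x. x \<epsilon> B \<Longrightarrow> f x \<epsilon> B" using B by (auto simp: F_iff)
  obtain C where C: "isset C" "\<And>x. x \<epsilon> C \<longleftrightarrow> x \<epsilon> B \<and> sat Sets ((env [g, B])(50 := x))
     (Exi 51 (Conj (Mem 51 1) (Rel 0 51 50)))"
    by (rule separation[of "[g, B]" B], use g \<open>isset B\<close> in simp, use g \<open>isset B\<close> in simp, blast)
  have C_iff: "x \<epsilon> C \<longleftrightarrow> (\<exists>t. t \<epsilon> B \<and> x = f t)" for x
  proof (cases "x \<epsilon> B")
    case True
    then show ?thesis using BX by (simp add: C(2) Bex_def) (metis g(2))
  qed (use into_B in \<open>auto simp: C(2)\<close>)
  obtain w where w: "w \<epsilon> B" "\<And>x. x \<epsilon> B \<Longrightarrow> w \<noteq> f x" using B by (auto simp: F_iff)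
  \<comment> \<open>As \<open>w\<close> is not in the image \<open>C\<close> of \<open>B\<close>,
    injectivity keeps \<open>f w\<close> out of the image of \<open>C\<close>; so \<open>f w\<close>
    witnesses that \<open>C\<close> belongs to \<open>F\<close>.\<close>
  have "f w \<noteq> f x" if "x \<epsilon> C" for x
    using that w BX inj into_B by (metis C_iff elts_iff inj_onD)
  moreover have "f w \<epsilon> C" using w by (auto simp: C_iff)
  ultimately have "C \<epsilon> F"
    using C(1) into_B BX unfolding F_iff by (auto simp: C_iff)
  then have "C = B" by (rule min) (use into_B in \<open>auto simp: C_iff\<close>)
  then show False using w C_iff by blast
qed

end

section \<open>Separation for intersections of thin classes\<close>

context THS
begin

lemma sat_UNIV_Sub [simp]:
  "i < 90 \<Longrightarrow> j < 90 \<Longrightarrow> sat UNIV e (Sub i j) \<longleftrightarrow> elts (e i) \<subseteq> elts (e j)"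
  by (auto simp: Sub_def)

lemma comprehension_env:
  obtains Y where "\<And>x. x \<epsilon> Y \<longleftrightarrow> isset x \<and> sat UNIV ((env ps)(50 := x)) \<phi>"
proof -
  obtain Y where Y: "elts Y = {x. isset x \<and> sat UNIV ((env ps)(50 := x)) \<phi>}"
    using comprehension by blast
  show ?thesis
    by (rule that[of Y]) (simp add: Y flip: elts_iff)
qed

lemma eq_singleton_iff:
  assumes "isset y" shows "x = adjoin empty_class y \<longleftrightarrow> (\<forall>z. z \<epsilon> x \<longleftrightarrow> z = y)"
  using assms by (simp add: ext_iff[of x])

text \<open>An injective image of a thin class under a set operation is thin. The members of \<open>X\<close> are
  the sets \<open>Pow W - Pow t\<close>, and these determine \<open>t\<close>.\<close>

lemma thin_complements:
  assumes T: "thin T" and W: "isset W" "\<And>t. t \<epsilon> T \<Longrightarrow> elts t \<subseteq> elts W"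
    and B: "isset B" "\<And>x. x \<epsilon> B \<longleftrightarrow> isset x \<and> elts x \<subseteq> elts W"
    and X: "\<And>w. w \<epsilon> X \<longleftrightarrow> isset w \<and> (\<exists>t. t \<epsilon> T \<and> (\<forall>x. x \<epsilon> w \<longleftrightarrow> x \<epsilon> B \<and> \<not> elts x \<subseteq> elts t))"
  shows "thin X"
proof -
  let ?G = "\<lambda>t w. \<forall>x. x \<epsilon> w \<longleftrightarrow> x \<epsilon> B \<and> \<not> elts x \<subseteq> elts t"
  \<comment> \<open>The singletons in \<open>B\<close> decide which elements of \<open>W\<close>
    belong to \<open>t\<close>, so \<open>w\<close> determines \<open>t\<close>.\<close>
  have inj: "t = t'" if "?G t w" "?G t' w" "elts t \<subseteq> elts W" "elts t' \<subseteq> elts W" for t t' w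
  proof -
    have "y \<epsilon> t \<longleftrightarrow> y \<epsilon> t'" if "y \<epsilon> W" for y
    proof -
      have y: "isset y" using that isset_mem by blast
      have "adjoin empty_class y \<epsilon> B" using that y by (simp add: B subset_iff)
      then have "\<not> elts (adjoin empty_class y) \<subseteq> elts t \<longleftrightarrow> \<not> elts (adjoin empty_class y) \<subseteq> elts t'"
        using \<open>?G t w\<close> \<open>?G t' w\<close> by blast
      then show ?thesis using y by (simp add: subset_iff)
    qed
    then show ?thesis using that(3,4) by (auto simp: ext_iff[of t] subset_iff)
  qed
  obtain \<tau> where \<tau>: "isset \<tau>" "elts T \<subseteq> elts \<tau>" using Thin[OF T] by blast
  show ?thesis
    unfolding thin_def small_def
  proof (intro allI impI, elim conjE)
    fix v Y assume v: "isset v" "elts v \<subseteq> elts X" and Y: "elts Y \<subseteq> elts v"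
    obtain v' where v': "isset v'" "\<And>t. t \<epsilon> v' \<longleftrightarrow> t \<epsilon> \<tau> \<and> sat Sets ((env [B, v, W])(50 := t))
        (Conj (Sub 50 2) (Exi 51 (Conj (Mem 51 1) (All 52 (Iff (Mem 52 51) (Conj (Mem 52 0) (Neg (Sub 52 50))))))))"
      by (rule separation[of "[B, v, W]" \<tau>], use B v W in simp, use \<tau> in simp, blast)
    have G: "?G t w \<longleftrightarrow> (\<forall>x. isset x \<longrightarrow> (x \<epsilon> w \<longleftrightarrow> x \<epsilon> B \<and> \<not> elts x \<subseteq> elts t))" for t w
      by (metis isset_mem)
    have v'_iff: "t \<epsilon> v' \<longleftrightarrow> t \<epsilon> \<tau> \<and> elts t \<subseteq> elts W \<and> (\<exists>w. w \<epsilon> v \<and> ?G t w)" for t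
      unfolding G using isset_mem[of _ v] by (auto simp: v' Bex_def)
    \<comment> \<open>\<open>v'\<close> is cut out of a set \<open>\<tau>\<close> that may exceed
      \<open>T\<close>; injectivity shows that only members of \<open>T\<close> were caught.\<close>
    have "elts v' \<subseteq> elts T"
    proof
      fix t assume "t \<in> elts v'"
      then obtain w where t: "elts t \<subseteq> elts W" "w \<epsilon> v" "?G t w" by (auto simp: v'_iff)
      have "w \<epsilon> X" using t(2) v(2) by auto
      then obtain t' where t': "t' \<epsilon> T" "?G t' w" using X[of w] by blast
      have "t = t'" by (rule inj[OF t(3) t'(2) t(1) W(2)[OF t'(1)]])
      then show "t \<in> elts T" using t' by simp
    qed
    then have small: "small v'" using T v' by (auto simp: thin_def)
    \<comment> \<open>The preimage of \<open>Y\<close> is formed by class comprehension, as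
      \<open>Y\<close> is not yet known to be a set. Smallness of \<open>v'\<close> makes it a set,
      after which separation inside \<open>v\<close> recovers \<open>Y\<close> as its image.\<close>
    obtain Y' where Y': "\<And>t. t \<epsilon> Y' \<longleftrightarrow> isset t \<and> sat UNIV ((env [B, Y, v'])(50 := t))
        (Conj (Mem 50 2) (Exi 51 (Conj (Mem 51 1) (All 52 (Iff (Mem 52 51) (Conj (Mem 52 0) (Neg (Sub 52 50))))))))"
      by (rule comprehension_env, blast)
    have Y'_iff: "t \<epsilon> Y' \<longleftrightarrow> t \<epsilon> v' \<and> (\<exists>w. w \<epsilon> Y \<and> ?G t w)" for t
      unfolding Y' using isset_mem[of t v'] by simp blast
    have "elts Y' \<subseteq> elts v'" by (auto simp: Y'_iff)
    then have "isset Y'" using small unfolding small_def by blast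
    obtain Z where Z: "isset Z" "\<And>w. w \<epsilon> Z \<longleftrightarrow> w \<epsilon> v \<and> sat Sets ((env [B, Y'])(50 := w))
        (Exi 51 (Conj (Mem 51 1) (All 52 (Iff (Mem 52 50) (Conj (Mem 52 0) (Neg (Sub 52 51)))))))"
      by (rule separation[of "[B, Y']" v], use B \<open>isset Y'\<close> in simp, use v in simp, blast)
    have Z_iff: "w \<epsilon> Z \<longleftrightarrow> w \<epsilon> v \<and> (\<exists>t. t \<epsilon> Y' \<and> ?G t w)" for w
      unfolding G using isset_mem[of _ Y'] by (auto simp: Z Bex_def)
    have "w \<epsilon> Z \<longleftrightarrow> w \<epsilon> Y" for w
    proof
      assume "w \<epsilon> Z"
      then obtain t w' where "w' \<epsilon> Y" "?G t w'" "?G t w" by (auto simp: Z_iff Y'_iff)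
      moreover from this have "w = w'" by (simp add: ext_iff[of w])
      ultimately show "w \<epsilon> Y" by simp
    next
      assume w: "w \<epsilon> Y"
      then have "w \<epsilon> v" using Y by auto
      then have "w \<epsilon> X" using v(2) by auto
      then obtain t where t: "t \<epsilon> T" "?G t w" using X[of w] by blast
      then have "t \<epsilon> v'" using \<tau>(2) W(2)[OF t(1)] \<open>w \<epsilon> v\<close> elts_iff unfolding v'_iff by blast
      then have "t \<epsilon> Y'" using w t(2) unfolding Y'_iff by blast
      then show "w \<epsilon> Z" using \<open>w \<epsilon> v\<close> t(2) unfolding Z_iff by blast
    qed
    then have "Z = Y" by (simp add: ext_iff[of Z])
    then show "isset Y" using Z by simp
  qed
qed

text \<open>A compactness argument. Let \<open>q\<close> consist of the
  \<open>x \<subseteq> W\<close> that contain both \<open>(z, s)\<close> and \<open>(s, e)\<close>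
  for some \<open>s\<close> in \<open>u\<close>. By disjointness each such \<open>x\<close> fails to
  be included in some \<open>t\<close> of \<open>T\<close>, so the sets \<open>Pow W - Pow t\<close>
  cover \<open>q\<close>. \<open>Comp\<close> leaves a set \<open>x0\<close> of these, and
  \<open>u0\<close> imposes \<open>(z, s) \<in> t\<close> only for the \<open>t\<close> that occur
  in \<open>x0\<close>.\<close>

lemma pi_class_separation:
  assumes "pi_class \<rho>" and u: "isset u" and z: "isset z" and e: "isset e"
    and ze: "\<not> pair z e \<epsilon> \<rho>"
    and disj: "\<And>s. s \<epsilon> u \<Longrightarrow> pair z s \<epsilon> \<rho> \<Longrightarrow> \<not> pair s e \<epsilon> \<rho>"
  obtains u0 where "isset u0" "elts u0 \<subseteq> elts u"
    "\<And>s. s \<epsilon> u \<Longrightarrow> pair z s \<epsilon> \<rho> \<Longrightarrow> s \<epsilon> u0" "\<And>s. s \<epsilon> u0 \<Longrightarrow> \<not> pair s e \<epsilon> \<rho>"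
proof -
  obtain T where T: "thin T" and \<rho>: "\<And>x. x \<epsilon> \<rho> \<longleftrightarrow> isset x \<and> (\<forall>t. t \<epsilon> T \<longrightarrow> x \<epsilon> t)"
  proof -
    from assms(1) obtain T where "thin T" "elts \<rho> = {x. isset x \<and> (\<forall>t\<in>elts T. x \<epsilon> t)}"
      unfolding pi_class_def by blast
    then show ?thesis by (intro that[of T]) (auto simp: set_eq_iff)
  qed
  \<comment> \<open>\<open>T\<close> is nonempty, as otherwise every set would belong to
    \<open>\<rho>\<close>; \<open>t0\<close> is used to place pairs of \<open>\<rho>\<close> inside
    \<open>W\<close>.\<close>
  obtain t0 where t0: "t0 \<epsilon> T" using ze z e by (auto simp: \<rho>)
  obtain \<tau> where \<tau>: "isset \<tau>" "elts T \<subseteq> elts \<tau>" using Thin[OF T] by blast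
  obtain W where W: "isset W" "\<And>x. x \<epsilon> W \<longleftrightarrow> (\<exists>t. t \<epsilon> \<tau> \<and> x \<epsilon> t)"
    using Union_set[OF \<tau>(1)] by blast
  have TW: "elts t \<subseteq> elts W" if "t \<epsilon> T" for t using that \<tau>(2) by (auto simp: W subset_iff)
  obtain B where B: "isset B" "\<And>x. x \<epsilon> B \<longleftrightarrow> isset x \<and> elts x \<subseteq> elts W"
    using powerset[OF W(1)] by blast
  let ?G = "\<lambda>t w. \<forall>x. x \<epsilon> w \<longleftrightarrow> x \<epsilon> B \<and> \<not> elts x \<subseteq> elts t"
  have G_ex: "\<exists>w. isset w \<and> ?G t w" if "isset t" for t
    by (rule separation[of "[t]" B "Neg (Sub 50 0)"], use that in simp, use B in simp, auto)
  obtain X where X: "\<And>w. w \<epsilon> X \<longleftrightarrow> isset w \<and> sat UNIV ((env [B, T])(50 := w))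
      (Exi 51 (Conj (Mem 51 1) (All 52 (Iff (Mem 52 50) (Conj (Mem 52 0) (Neg (Sub 52 51)))))))"
    by (rule comprehension_env, blast)
  have X_iff: "w \<epsilon> X \<longleftrightarrow> isset w \<and> (\<exists>t. t \<epsilon> T \<and> ?G t w)" for w
    by (simp add: X)
  have thin: "thin X" by (rule thin_complements[OF T W(1) TW B X_iff])
  obtain q where q: "isset q" "\<And>x. x \<epsilon> q \<longleftrightarrow> x \<epsilon> B \<and> sat Sets ((env [u, z, e])(50 := x))
      (Exi 51 (Conj (Mem 51 0) (Exi 52 (Conj (IsPair 52 1 51) (Exi 53 (Conj (IsPair 53 51 2)
        (Conj (Mem 52 50) (Mem 53 50))))))))"
    by (rule separation[of "[u, z, e]" B], use u z e in simp, use B in simp, blast)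
  have q_iff: "x \<epsilon> q \<longleftrightarrow> x \<epsilon> B \<and> (\<exists>s. s \<epsilon> u \<and> pair z s \<epsilon> x \<and> pair s e \<epsilon> x)" for x
    using z e by (simp add: q(2) Bex_def) (metis isset_mem)
  have "elts q \<subseteq> (\<Union>t\<in>elts X. elts t)"
  proof
    fix x assume "x \<in> elts q"
    then obtain s where s: "x \<epsilon> B" "s \<epsilon> u" "pair z s \<epsilon> x" "pair s e \<epsilon> x" by (auto simp: q_iff)
    have "\<not> (pair z s \<epsilon> \<rho> \<and> pair s e \<epsilon> \<rho>)" using disj s(2) by blast
    then obtain t where t: "t \<epsilon> T" "\<not> (pair z s \<epsilon> t \<and> pair s e \<epsilon> t)"
      using isset_mem[OF s(2)] z e by (auto simp: \<rho>)
    obtain w where w: "isset w" "?G t w" using G_ex isset_mem[OF t(1)] by blast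
    have "x \<epsilon> w" using w(2) s t(2) by (auto simp: subset_iff)
    moreover have "w \<epsilon> X" using w t(1) unfolding X_iff by blast
    ultimately show "x \<in> (\<Union>t\<in>elts X. elts t)" by auto
  qed
  then obtain x0 where x0: "isset x0" "elts x0 \<subseteq> elts X" "elts q \<subseteq> (\<Union>t\<in>elts x0. elts t)"
    using Comp[OF thin q(1)] by blast
  \<comment> \<open>For \<open>w = Pow W - Pow t\<close>, the condition that the singleton of
    \<open>(z, s)\<close> is not in \<open>w\<close> says that \<open>(z, s)\<close> belongs to
    \<open>t\<close>. Index 53 is this singleton.\<close>
  obtain u0 where u0: "isset u0" "\<And>s. s \<epsilon> u0 \<longleftrightarrow> s \<epsilon> u \<and> sat Sets ((env [z, W, x0])(50 := s))
      (Exi 51 (Conj (IsPair 51 0 50) (Conj (Mem 51 1) (All 52 (Imp (Mem 52 2)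
        (All 53 (Imp (All 54 (Iff (Mem 54 53) (Eq 54 51))) (Neg (Mem 53 52)))))))))"
    by (rule separation[of "[z, W, x0]" u], use W z x0 in simp, use u in simp, blast)
  have sing: "(\<forall>y. isset y \<longrightarrow> (y \<epsilon> x \<longleftrightarrow> y = p)) \<longleftrightarrow> x = adjoin empty_class p" if "isset p" for x p
    using that by (metis eq_singleton_iff isset_mem)
  have u0_iff: "s \<epsilon> u0 \<longleftrightarrow> s \<epsilon> u \<and> pair z s \<epsilon> W \<and> (\<forall>w. w \<epsilon> x0 \<longrightarrow> \<not> adjoin empty_class (pair z s) \<epsilon> w)" for s
  proof (cases "s \<epsilon> u")
    case True
    then have "isset s" using isset_mem by blast
    then show ?thesis using True z by (simp add: u0(2) sing) (metis isset_mem)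
  qed (simp add: u0)
  show ?thesis
  proof (rule that[OF u0(1)])
    show "elts u0 \<subseteq> elts u" by (auto simp: u0_iff)
  next
    fix s assume s: "s \<epsilon> u" "pair z s \<epsilon> \<rho>"
    then have "pair z s \<epsilon> t" if "t \<epsilon> T" for t using that by (auto simp: \<rho>)
    moreover have "isset (pair z s)" using isset_mem[OF s(1)] z by simp
    ultimately have "\<not> adjoin empty_class (pair z s) \<epsilon> w" if "w \<epsilon> x0" for w
      using that x0(2) by (auto simp: X_iff subset_iff)
    moreover have "pair z s \<epsilon> W" using \<open>\<And>t. t \<epsilon> T \<Longrightarrow> pair z s \<epsilon> t\<close>[OF t0] TW[OF t0] by auto
    ultimately show "s \<epsilon> u0" using s(1) by (simp add: u0_iff)
  next
    fix s assume s: "s \<epsilon> u0"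
    show "\<not> pair s e \<epsilon> \<rho>"
    proof
      assume se: "pair s e \<epsilon> \<rho>"
      have "isset s" using s isset_mem by blast
      let ?p = "pair z s" and ?p' = "pair s e"
      \<comment> \<open>The test element \<open>{(z, s), (s, e)}\<close> lies in \<open>q\<close>
        and hence in some \<open>w\<close> of \<open>x0\<close>, although both pairs belong to the
        corresponding \<open>t\<close>.\<close>
      let ?x = "adjoin (adjoin empty_class ?p) ?p'"
      have set: "isset ?p" "isset ?p'" using \<open>isset s\<close> z e by simp_all
      have "?p' \<epsilon> W" using se t0 TW[OF t0] by (auto simp: \<rho> subset_iff)
      then have "?x \<epsilon> q" using s set by (auto simp: q_iff B u0_iff)
      then obtain w where w: "w \<epsilon> x0" "?x \<epsilon> w" using x0(3) by auto
      have "w \<epsilon> X" using x0(2) w(1) by auto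
      then obtain t where t: "t \<epsilon> T" "?G t w" unfolding X_iff by blast
      have "adjoin empty_class ?p \<epsilon> B" using s set by (auto simp: B u0_iff)
      then have "?p \<epsilon> t" using s w(1) t(2) set by (auto simp: u0_iff subset_iff)
      moreover have "?p' \<epsilon> t" using se t(1) by (simp add: \<rho>)
      ultimately have "elts ?x \<subseteq> elts t" using set by auto
      then show False using w(2) t(2) by blast
    qed
  qed
qed

end

section \<open>Rings without unit\<close>

locale rng = abelian_group R for R (structure) +
  assumes m_closed [intro, simp]: "x \<in> carrier R \<Longrightarrow> y \<in> carrier R \<Longrightarrow> x \<otimes> y \<in> carrier R"
    and m_assoc: "x \<in> carrier R \<Longrightarrow> y \<in> carrier R \<Longrightarrow> z \<in> carrier R \<Longrightarrow> (x \<otimes> y) \<otimes> z = x \<otimes> (y \<otimes> z)"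
    and r_distr: "x \<in> carrier R \<Longrightarrow> y \<in> carrier R \<Longrightarrow> z \<in> carrier R \<Longrightarrow> x \<otimes> (y \<oplus> z) = x \<otimes> y \<oplus> x \<otimes> z"
    and l_distr: "x \<in> carrier R \<Longrightarrow> y \<in> carrier R \<Longrightarrow> z \<in> carrier R \<Longrightarrow> (x \<oplus> y) \<otimes> z = x \<otimes> z \<oplus> y \<otimes> z"
begin

lemma r_null [simp]: "x \<in> carrier R \<Longrightarrow> x \<otimes> \<zero> = \<zero>"
  using r_distr[of x \<zero> \<zero>] by (simp add: add.l_cancel_one)

lemma l_null [simp]: "x \<in> carrier R \<Longrightarrow> \<zero> \<otimes> x = \<zero>"
  using l_distr[of \<zero> \<zero> x] by (simp add: add.l_cancel_one)

lemma r_minus: "x \<in> carrier R \<Longrightarrow> y \<in> carrier R \<Longrightarrow> x \<otimes> (\<ominus> y) = \<ominus> (x \<otimes> y)"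
  using r_distr[of x "\<ominus> y" y] by (simp add: l_neg minus_equality)

lemma l_minus: "x \<in> carrier R \<Longrightarrow> y \<in> carrier R \<Longrightarrow> (\<ominus> x) \<otimes> y = \<ominus> (x \<otimes> y)"
  using l_distr[of "\<ominus> x" x y] by (simp add: l_neg minus_equality)

text \<open>Turns subtraction into addition, which formulas can express through the graph of the
  sum.\<close>

lemma eq_diff_iff:
  assumes "x \<in> carrier R" "y \<in> carrier R" "z \<in> carrier R"
  shows "x = y \<ominus> z \<longleftrightarrow> x \<oplus> z = y"
proof
  assume "x = y \<ominus> z"
  then show "x \<oplus> z = y" using assms by (simp add: a_minus_def a_assoc l_neg)
next
  assume "x \<oplus> z = y"
  then have "y \<ominus> z = x \<oplus> (z \<oplus> \<ominus> z)" using assms by (simp add: a_minus_def a_assoc[symmetric])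
  then show "x = y \<ominus> z" using assms by (simp add: r_neg)
qed

text \<open>Clears subtractions from an equation. This matters because the homomorphism respects the
  operations only on \<open>Rb\<close>, where differences need not lie.\<close>

lemma diff_eq_diff:
  assumes "x \<in> carrier R" "y \<in> carrier R" "u \<in> carrier R" "v \<in> carrier R" "x \<ominus> y = u \<ominus> v"
  shows "x \<oplus> v = u \<oplus> y"
proof -
  have "x = (u \<ominus> v) \<oplus> y" using assms eq_diff_iff[of "u \<ominus> v" x y] by auto
  then have "x \<oplus> v = ((u \<ominus> v) \<oplus> v) \<oplus> y" using assms by (simp add: a_ac)
  also have "(u \<ominus> v) \<oplus> v = u" using assms eq_diff_iff[of "u \<ominus> v" u v] by simp
  finally show ?thesis .
qed

lemma eq_if_diff_zero:
  "x \<in> carrier R \<Longrightarrow> y \<in> carrier R \<Longrightarrow> x \<ominus> y = \<zero> \<Longrightarrow> x = y"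
  using eq_diff_iff[of \<zero> x y] by simp

lemma diff_add_diff:
  assumes "x \<in> carrier R" "y \<in> carrier R" "u \<in> carrier R" "v \<in> carrier R"
  shows "(x \<ominus> y) \<oplus> (u \<ominus> v) = (x \<oplus> u) \<ominus> (y \<oplus> v)"
  using assms by (simp add: a_minus_def minus_add a_ac)

lemma r_diff: "x \<in> carrier R \<Longrightarrow> y \<in> carrier R \<Longrightarrow> z \<in> carrier R \<Longrightarrow> x \<otimes> (y \<ominus> z) = x \<otimes> y \<ominus> x \<otimes> z"
  by (simp add: a_minus_def r_distr r_minus)

lemma l_diff: "x \<in> carrier R \<Longrightarrow> y \<in> carrier R \<Longrightarrow> z \<in> carrier R \<Longrightarrow> (y \<ominus> z) \<otimes> x = y \<otimes> x \<ominus> z \<otimes> x"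
  by (simp add: a_minus_def l_distr l_minus)

end

text \<open>The record has a slot for a unit; it receives the filler \<open>undefined\<close>, about
  which \<open>rng\<close> assumes nothing.\<close>

lemma rng_of_associative_ring:
  assumes "associative_ring A pl ml"
  obtains z where "rng \<lparr>carrier = A, mult = ml, one = undefined, zero = z, add = pl\<rparr>"
proof -
  obtain z where z: "comm_group \<lparr>carrier = A, mult = pl, one = z\<rparr>"
    using assms by (auto simp: associative_ring_def)
  let ?G = "\<lparr>carrier = A, mult = ml, one = undefined, zero = z, add = pl\<rparr>"
  have "comm_group (add_monoid ?G)" using z by simp
  then have "abelian_group ?G"
    by (simp add: abelian_group_def abelian_group_axioms_def abelian_monoid_def comm_group_def)
  then have "rng ?G"
    using assms by (auto simp: rng_def rng_axioms_def associative_ring_def)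
  then show ?thesis by (rule that)
qed

context THS
begin

section \<open>The algebraic contradiction\<close>

text \<open>The topology has been distilled into the assumptions on \<open>u\<close> and
  \<open>nonset\<close>: a set between the kernel and \<open>Rb\<close> that avoids the fibre over
  one, and a kernel that is not itself a set.\<close>

lemma no_set_ring_with_nondiscrete_field_quotient:
  fixes G :: "('a, 'b) ring_scheme" (structure) and K :: "('k, 'l) ring_scheme"
  assumes "rng G" and "field K" and r: "isset r" and carrier: "carrier G = elts r"
    and ops: "isset pl" "graph2 pl (add G) (elts r)" "isset ml" "graph2 ml (mult G) (elts r)"
    and Rb: "Rb \<subseteq> carrier G" "\<And>x y. x \<in> Rb \<Longrightarrow> y \<in> Rb \<Longrightarrow> x \<oplus> y \<in> Rb" "\<And>x y. x \<in> Rb \<Longrightarrow> y \<in> Rb \<Longrightarrow> x \<otimes> y \<in> Rb"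
    and h_surj: "h ` Rb = carrier K"
    and h_add: "\<And>x y. x \<in> Rb \<Longrightarrow> y \<in> Rb \<Longrightarrow> h (x \<oplus> y) = h x \<oplus>\<^bsub>K\<^esub> h y"
    and h_mult: "\<And>x y. x \<in> Rb \<Longrightarrow> y \<in> Rb \<Longrightarrow> h (x \<otimes> y) = h x \<otimes>\<^bsub>K\<^esub> h y"
    and u: "isset u" "elts u \<subseteq> Rb" "{a \<in> Rb. h a = \<zero>\<^bsub>K\<^esub>} \<subseteq> elts u" "\<And>a. a \<epsilon> u \<Longrightarrow> h a \<noteq> \<one>\<^bsub>K\<^esub>"
    and nonset: "\<And>S. isset S \<Longrightarrow> elts S \<noteq> {a \<in> Rb. h a = \<zero>\<^bsub>K\<^esub>}"
  shows False
proof -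
  interpret rng G by fact
  interpret K: field K by fact
  let ?S = "{a \<in> Rb. h a = \<zero>\<^bsub>K\<^esub>}"
  have car: "x \<in> carrier G \<longleftrightarrow> x \<epsilon> r" for x by (simp add: carrier)
  have isset_r: "isset x" if "x \<in> carrier G" for x using that car isset_mem by blast
  have h_in: "h x \<in> carrier K" if "x \<in> Rb" for x using h_surj that by blast
  have Rb_r: "x \<in> carrier G" if "x \<in> Rb" for x using that Rb(1) by blast
  have u_Rb: "x \<in> Rb" if "x \<epsilon> u" for x using that u(2) by auto
  have S_u: "x \<epsilon> u" if "x \<in> Rb" "h x = \<zero>\<^bsub>K\<^esub>" for x using that u(3) by auto
  have gm: "pair (pair x y) v \<epsilon> ml \<longleftrightarrow> v = x \<otimes> y" if "x \<in> carrier G" "y \<in> carrier G" "isset v" for x y v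
    using ops that car by (simp add: graph2_def)
  have ga: "pair (pair x y) v \<epsilon> pl \<longleftrightarrow> v = x \<oplus> y" if "x \<in> carrier G" "y \<in> carrier G" "isset v" for x y v
    using ops that car by (simp add: graph2_def)
  \<comment> \<open>Removes the quantifiers over intermediate products that arise when nested terms
    are written with \<open>Op\<close>.\<close>
  have exm: "(\<exists>v. isset v \<and> pair (pair x y) v \<epsilon> ml \<and> P v) \<longleftrightarrow> P (x \<otimes> y)"
    if "x \<in> carrier G" "y \<in> carrier G" for x y P
    using gm[OF that] isset_r[OF m_closed[OF that]] by blast
  define T where "T b c v = (b \<otimes> v) \<otimes> c \<oplus> v" for b c v

  obtain M where M: "isset M" "\<And>v. v \<epsilon> M \<longleftrightarrow> v \<epsilon> u \<and> sat Sets ((env [ml, u])(50 := v))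
      (All 51 (Imp (Mem 51 1) (Exi 52 (Conj (Op 0 50 51 52) (Mem 52 1)))))"
    by (rule separation[of "[ml, u]" u], use ops u in simp, use u in simp, blast)
  have M_iff: "v \<epsilon> M \<longleftrightarrow> v \<epsilon> u \<and> (\<forall>x. x \<epsilon> u \<longrightarrow> v \<otimes> x \<epsilon> u)" for v
  proof (cases "v \<epsilon> u")
    case True
    then show ?thesis
      using isset_r Rb_r u_Rb by (auto simp: M(2) Bex_def exm)
  qed (simp add: M(2))
  obtain b where b: "b \<epsilon> M" "h b \<noteq> \<zero>\<^bsub>K\<^esub>"
  proof -
    \<comment> \<open>The kernel absorbs products with elements of \<open>Rb\<close>, so for
      \<open>v\<close> in it \<open>v u\<close> stays in \<open>?S\<close> and thus in
      \<open>u\<close>.\<close>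
    have "?S \<subseteq> elts M"
      using S_u Rb h_mult h_in u_Rb by (auto simp: M_iff)
    moreover have "elts M \<noteq> ?S" using nonset M(1) by blast
    ultimately obtain b where "b \<in> elts M" "b \<notin> ?S" by blast
    then show ?thesis using that[of b] u_Rb by (auto simp: M_iff)
  qed
  have bu: "b \<epsilon> u" using b(1) by (simp add: M_iff)
  have bR: "b \<in> Rb" and bG: "b \<in> carrier G" using bu u_Rb Rb_r by auto
  obtain c where c: "c \<in> Rb" "h c = (\<ominus>\<^bsub>K\<^esub> (inv\<^bsub>K\<^esub> (h b)))"
  proof -
    have "(\<ominus>\<^bsub>K\<^esub> (inv\<^bsub>K\<^esub> (h b))) \<in> carrier K"
      using h_in[OF bR] b(2) K.field_Units by (auto intro!: K.a_inv_closed)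
    then show ?thesis using h_surj that by (metis imageE)
  qed
  have cG: "c \<in> carrier G" using c Rb_r by blast
  have T_closed: "T b c v \<in> carrier G" if "v \<in> carrier G" for v
    using that bG cG by (simp add: T_def)
  have T_S: "T b c v \<in> Rb" "h (T b c v) = \<zero>\<^bsub>K\<^esub>" if v: "v \<in> Rb" for v
  proof -
    show "T b c v \<in> Rb" using Rb bR c(1) v by (simp add: T_def)
    have U: "h b \<in> Units K" using h_in[OF bR] b(2) K.field_Units by blast
    then have i: "inv\<^bsub>K\<^esub> (h b) \<in> carrier K" by simp
    have "h (T b c v) = (h b \<otimes>\<^bsub>K\<^esub> h v) \<otimes>\<^bsub>K\<^esub> (\<ominus>\<^bsub>K\<^esub> (inv\<^bsub>K\<^esub> (h b))) \<oplus>\<^bsub>K\<^esub> h v"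
      using Rb bR c v by (simp add: T_def h_add h_mult)
    also have "(h b \<otimes>\<^bsub>K\<^esub> h v) \<otimes>\<^bsub>K\<^esub> (\<ominus>\<^bsub>K\<^esub> (inv\<^bsub>K\<^esub> (h b))) = \<ominus>\<^bsub>K\<^esub> (h v \<otimes>\<^bsub>K\<^esub> (h b \<otimes>\<^bsub>K\<^esub> inv\<^bsub>K\<^esub> (h b)))"
      using i h_in[OF bR] h_in[OF v] by (simp add: K.r_minus K.m_ac)
    also have "\<dots> = \<ominus>\<^bsub>K\<^esub> h v" using U h_in[OF v] by simp
    finally show "h (T b c v) = \<zero>\<^bsub>K\<^esub>" using h_in[OF v] by (simp add: K.l_neg)
  qed
  \<comment> \<open>\<open>Z\<close> is the kernel of \<open>T b c\<close> in all of
    \<open>r\<close>, because differences of elements of \<open>p u\<close> may leave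
    \<open>Rb\<close>. Index 51 is \<open>b v\<close> and 52 is \<open>(b v) c\<close>.\<close>
  obtain Z where Z: "isset Z" "\<And>v. v \<epsilon> Z \<longleftrightarrow> v \<epsilon> r \<and> sat Sets ((env [pl, ml, b, c, \<zero>])(50 := v))
      (Exi 51 (Conj (Op 1 2 50 51) (Exi 52 (Conj (Op 1 51 3 52) (Op 0 52 50 4)))))"
    by (rule separation[of "[pl, ml, b, c, \<zero>]" r], use ops isset_r bG cG in simp, use r in simp, blast)
  have Z_iff: "v \<epsilon> Z \<longleftrightarrow> v \<in> carrier G \<and> T b c v = \<zero>" for v
  proof (cases "v \<epsilon> r")
    case True
    then have "v \<in> carrier G" by (simp add: car)
    then show ?thesis
      using True isset_r bG cG by (auto simp: Z(2) Bex_def exm ga T_def)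
  qed (simp add: Z(2) car)
  \<comment> \<open>The last clause demands that left multiplication by \<open>a\<close> maps
    \<open>Z\<close> to itself with trivial kernel, which by additivity means injectivity on
    \<open>Z\<close>.\<close>
  obtain U where U: "isset U" "\<And>v. v \<epsilon> U \<longleftrightarrow> v \<epsilon> M \<and> sat Sets ((env [ml, b, Z, \<zero>])(50 := v))
      (Conj (Exi 51 (Conj (Op 0 50 1 51) (Op 0 1 50 51)))
        (All 51 (Imp (Mem 51 2) (Exi 52 (Conj (Op 0 50 51 52) (Conj (Mem 52 2) (Imp (Eq 52 3) (Eq 51 3))))))))"
    by (rule separation[of "[ml, b, Z, \<zero>]" M], use ops isset_r bG Z in simp, use M in simp, blast)
  have U_iff: "a \<epsilon> U \<longleftrightarrow> a \<epsilon> M \<and> a \<otimes> b = b \<otimes> a \<and> (\<forall>v. v \<epsilon> Z \<longrightarrow> a \<otimes> v \<epsilon> Z \<and> (a \<otimes> v = \<zero> \<longrightarrow> v = \<zero>))" for a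
  proof (cases "a \<epsilon> M")
    case True
    then have a: "a \<in> carrier G" using M_iff u_Rb Rb_r by blast
    have "x \<in> carrier G" if "x \<epsilon> Z" for x using that by (simp add: Z_iff)
    then show ?thesis
      using True a isset_r bG by (auto simp: U(2) Bex_def exm gm)
  qed (simp add: U(2))
  have UG: "a \<in> carrier G" if "a \<epsilon> U" for a using that U_iff M_iff u_Rb Rb_r by blast
  have "b \<epsilon> U"
    unfolding U_iff
  proof (intro conjI allI impI)
    fix v assume "v \<epsilon> Z"
    then have v: "v \<in> carrier G" "T b c v = \<zero>" by (simp_all add: Z_iff)
    have "T b c (b \<otimes> v) = b \<otimes> T b c v"
      using v(1) bG cG by (simp add: T_def r_distr m_assoc)
    then show "b \<otimes> v \<epsilon> Z" using v bG by (simp add: Z_iff)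
    \<comment> \<open>If \<open>b v = 0\<close>, then \<open>T b c v = v\<close>, and the left side
      vanishes on \<open>Z\<close>.\<close>
    show "v = \<zero>" if "b \<otimes> v = \<zero>" using v that bG cG by (simp add: T_def)
  qed (use b in auto)
  moreover have "graph2 ml (mult G) (elts U)"
    using gm UG by (simp add: graph2_def)
  moreover have "x \<otimes> y \<epsilon> U" if "x \<epsilon> U" "y \<epsilon> U" for x y
    unfolding U_iff
  proof (intro conjI allI impI)
    have G: "x \<in> carrier G" "y \<in> carrier G" using that UG by auto
    have M': "x \<epsilon> M" "y \<epsilon> M" using that by (auto simp: U_iff)
    then have "x \<otimes> y \<otimes> a \<epsilon> u" if "a \<epsilon> u" for a
      using that G u_Rb Rb_r by (simp add: M_iff m_assoc)
    moreover have "x \<otimes> y \<epsilon> u" using M' by (simp add: M_iff)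
    ultimately show "x \<otimes> y \<epsilon> M" by (simp add: M_iff)
    have "x \<otimes> b = b \<otimes> x" "y \<otimes> b = b \<otimes> y" using that by (auto simp: U_iff)
    then show "x \<otimes> y \<otimes> b = b \<otimes> (x \<otimes> y)" using G bG by (metis m_assoc)
    fix v assume v: "v \<epsilon> Z"
    then have assoc: "x \<otimes> y \<otimes> v = x \<otimes> (y \<otimes> v)" using G by (simp add: m_assoc Z_iff)
    show "x \<otimes> y \<otimes> v \<epsilon> Z" using that v by (simp add: assoc U_iff)
    show "v = \<zero>" if "x \<otimes> y \<otimes> v = \<zero>" using that \<open>x \<epsilon> U\<close> \<open>y \<epsilon> U\<close> v assoc unfolding U_iff by metis
  qed
  ultimately obtain j where j: "j \<epsilon> U" "j \<otimes> j = j"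
    using idempotent_exists[OF U(1) _ ops(3), of b "mult G"] UG m_assoc by metis
  have jG: "j \<in> carrier G" and ju: "j \<epsilon> u" and jR: "j \<in> Rb" and jb: "j \<otimes> b = b \<otimes> j"
    using j UG U_iff M_iff u_Rb by auto
  have hj: "h j = \<zero>\<^bsub>K\<^esub>"
  proof (rule ccontr)
    assume ne: "h j \<noteq> \<zero>\<^bsub>K\<^esub>"
    have "h j \<otimes>\<^bsub>K\<^esub> h j = h j \<otimes>\<^bsub>K\<^esub> \<one>\<^bsub>K\<^esub>" using h_mult[OF jR jR] j(2) h_in[OF jR] by simp
    then have "h j = \<one>\<^bsub>K\<^esub>" using ne h_in[OF jR] K.m_lcancel[of "h j" "h j" "\<one>\<^bsub>K\<^esub>"] by simp
    then show False using u(4) ju by blast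
  qed
  have T_diff: "T b c (v \<ominus> w) = T b c v \<ominus> T b c w" if "v \<in> carrier G" "w \<in> carrier G" for v w
    using that bG cG by (simp add: T_def r_diff l_diff diff_add_diff)
  define p where "p a = a \<ominus> j \<otimes> a" for a
  have p_closed: "p a \<in> carrier G" if "a \<in> carrier G" for a using that jG by (simp add: p_def)
  have jp: "j \<otimes> p a = \<zero>" if "a \<in> carrier G" for a
    using that jG by (simp add: p_def r_diff m_assoc[symmetric] j(2)) (simp add: a_minus_def r_neg)
  have Tp: "T b c (p a) = p (T b c a)" if a: "a \<in> carrier G" for a
  proof -
    \<comment> \<open>Since \<open>j\<close> commutes with \<open>b\<close>, it can be moved to the
      front of \<open>(b (j a)) c + j a\<close>.\<close>
    have "T b c (j \<otimes> a) = j \<otimes> T b c a"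
      using a bG cG jG jb by (simp add: T_def r_distr m_assoc[symmetric])
    then show ?thesis using a jG by (simp add: p_def T_diff)
  qed
  \<comment> \<open>\<open>X\<close> is the image \<open>p u\<close>; the equation
    \<open>v = a - j a\<close> is written as \<open>v + j a = a\<close>.\<close>
  obtain X where X: "isset X" "\<And>v. v \<epsilon> X \<longleftrightarrow> v \<epsilon> r \<and> sat Sets ((env [pl, ml, j, u])(50 := v))
      (Exi 51 (Conj (Mem 51 3) (Exi 52 (Conj (Op 1 2 51 52) (Op 0 50 52 51)))))"
    by (rule separation[of "[pl, ml, j, u]" r], use ops isset_r jG u in simp, use r in simp, blast)
  have X_iff: "v \<epsilon> X \<longleftrightarrow> (\<exists>a. a \<epsilon> u \<and> v = p a)" for v
  proof (cases "v \<epsilon> r")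
    case True
    then have v: "v \<in> carrier G" by (simp add: car)
    have "a = v \<oplus> j \<otimes> a \<longleftrightarrow> v = p a" if "a \<epsilon> u" for a
      using eq_diff_iff[of v a "j \<otimes> a"] v jG that u_Rb Rb_r by (auto simp: p_def)
    moreover have "isset a" "a \<in> carrier G" if "a \<epsilon> u" for a using that u_Rb Rb_r isset_r by auto
    ultimately have "(isset a \<and> a \<epsilon> u \<and> (\<exists>w. isset w \<and> pair (pair j a) w \<epsilon> ml \<and> pair (pair v w) a \<epsilon> pl)) \<longleftrightarrow>
        (a \<epsilon> u \<and> v = p a)" for a
      using v jG by (cases "a \<epsilon> u") (simp_all add: exm ga)
    then show ?thesis
      using True v isset_r jG u(1) by (simp add: X(2) Bex_def cong: conj_cong)
  next
    case False
    then show ?thesis using p_closed u_Rb Rb_r car by (auto simp: X(2))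
  qed
  have XG: "v \<in> carrier G" if "v \<epsilon> X" for v using that p_closed u_Rb Rb_r by (auto simp: X_iff)
  obtain XX where XX: "isset XX" "\<And>q. q \<epsilon> XX \<longleftrightarrow> (\<exists>x y. x \<epsilon> X \<and> y \<epsilon> X \<and> q = pair x y)"
    using product_set[OF X(1) X(1)] by blast
  obtain g where g: "isset g" "\<And>q. q \<epsilon> g \<longleftrightarrow> q \<epsilon> XX \<and> sat Sets ((env [pl, ml, b, c, X])(50 := q))
      (Exi 51 (Conj (Mem 51 4) (Exi 52 (Conj (IsPair 50 51 52) (Exi 53 (Conj (Op 1 2 51 53)
        (Exi 54 (Conj (Op 1 53 3 54) (Op 0 54 51 52)))))))))"
    by (rule separation[of "[pl, ml, b, c, X]" XX], use ops isset_r bG cG X in simp, use XX in simp, blast)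
  have g_iff: "pair x y \<epsilon> g \<longleftrightarrow> y = T b c x" if xy: "x \<epsilon> X" "y \<epsilon> X" for x y
  proof -
    have set: "isset x" "isset y" using xy XG isset_r by auto
    have "pair x y \<epsilon> XX" using xy XX by blast
    moreover have "isset v" "v \<in> carrier G" if "v \<epsilon> X" for v using that XG isset_r by auto
    moreover have "(\<exists>w. isset w \<and> pair (pair b x) w \<epsilon> ml \<and>
        (\<exists>w'. isset w' \<and> pair (pair w c) w' \<epsilon> ml \<and> pair (pair w' x) y \<epsilon> pl)) \<longleftrightarrow> y = T b c x"
      using xy XG bG cG set by (simp add: exm ga T_def)
    ultimately show ?thesis
      using xy bG cG isset_r set by (simp add: g(2) Bex_def cong: conj_cong)
  qed
  have "\<exists>v. v \<epsilon> X \<and> T b c v = p b"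
  proof (rule inj_endo_surj[OF X(1) g(1) g_iff])
    \<comment> \<open>\<open>T (p a) = p (T a)\<close>, and \<open>T a\<close> lies in the kernel,
      hence in \<open>u\<close>.\<close>
    show "T b c x \<epsilon> X" if "x \<epsilon> X" for x
      using that T_S S_u u_Rb Rb_r Tp unfolding X_iff by metis
    show "p b \<epsilon> X" using bu by (auto simp: X_iff)
    show "inj_on (T b c) (elts X)"
    proof (rule inj_onI)
      fix v w assume vw: "v \<in> elts X" "w \<in> elts X" and eq: "T b c v = T b c w"
      have G: "v \<in> carrier G" "w \<in> carrier G" using vw XG by auto
      \<comment> \<open>The difference lies in \<open>Z\<close> and is annihilated by
        \<open>j\<close>, because \<open>j p = 0\<close>; membership of \<open>j\<close> in
        \<open>U\<close> then forces it to vanish.\<close>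
      have "T b c (v \<ominus> w) = \<zero>" using eq G T_closed by (simp add: T_diff) (simp add: a_minus_def r_neg)
      then have "v \<ominus> w \<epsilon> Z" using G by (simp add: Z_iff)
      moreover have "j \<otimes> v = \<zero>" "j \<otimes> w = \<zero>" using vw jp u_Rb Rb_r by (auto simp: X_iff)
      then have "j \<otimes> (v \<ominus> w) = \<zero>" using G jG by (simp add: r_diff) (simp add: a_minus_def)
      ultimately have "v \<ominus> w = \<zero>" using j(1) unfolding U_iff by blast
      then show "v = w" using G eq_if_diff_zero by blast
    qed
  qed
  then obtain a where a: "a \<epsilon> u" "T b c (p a) = p b" by (auto simp: X_iff)
  let ?s = "T b c a"
  have aR: "a \<in> Rb" using a u_Rb by blast
  have sR: "?s \<in> Rb" "h ?s = \<zero>\<^bsub>K\<^esub>" using T_S[OF aR] by auto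
  have "b \<ominus> j \<otimes> b = ?s \<ominus> j \<otimes> ?s" using a(2) Tp aR Rb_r by (simp add: p_def)
  \<comment> \<open>Both sides now lie in \<open>Rb\<close>, so \<open>h\<close> may be applied; it
    annihilates \<open>?s\<close> and every multiple of \<open>j\<close>, leaving
    \<open>h b = 0\<close>.\<close>
  then have "b \<oplus> j \<otimes> ?s = ?s \<oplus> j \<otimes> b"
    using diff_eq_diff bG jG sR(1) Rb_r by simp
  then have "h (b \<oplus> j \<otimes> ?s) = h (?s \<oplus> j \<otimes> b)" by simp
  then have "h b = \<zero>\<^bsub>K\<^esub>"
    using bR jR sR Rb hj h_in by (simp add: h_add h_mult)
  with b(2) show False ..
qed

end

section \<open>The topology of the real numbers\<close>

context THS
begin

text \<open>Functionality of \<open>f\<close> makes the description in \<open>app\<close> unique, so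
  a coded operation becomes a HOL operation to which formulas have access.\<close>

lemma binop_on_graph2:
  assumes "binop_on f A"
  shows "graph2 f (app2 f) (elts A)" and "\<And>a b. a \<epsilon> A \<Longrightarrow> b \<epsilon> A \<Longrightarrow> app2 f a b \<epsilon> A"
proof -
  have fn: "is_function f" and dom: "dom_of f = {pair a b | a b. a \<in> elts A \<and> b \<in> elts A}"
    and im: "app f ` dom_of f \<subseteq> elts A"
    using assms by (auto simp: binop_on_def is_map_def)
  show "graph2 f (app2 f) (elts A)"
    unfolding graph2_def
  proof (intro ballI allI impI)
    fix a b v assume ab: "a \<in> elts A" "b \<in> elts A" and v: "isset v"
    have set: "isset (pair a b)" using ab isset_mem by (metis elts_iff isset_pair)
    have "pair a b \<in> dom_of f" using ab by (auto simp: dom)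
    then obtain y where y: "rel f (pair a b) y" by (auto simp: dom_of_def)
    have uniq: "y' = y" if "rel f (pair a b) y'" for y' using fn y that by (auto simp: is_function_def)
    have "app2 f a b = y" unfolding app2_def app_def using y uniq by (rule the_equality)
    moreover have "pair (pair a b) v \<epsilon> f \<longleftrightarrow> rel f (pair a b) v" using v set by (simp add: rel_def)
    ultimately show "pair (pair a b) v \<epsilon> f \<longleftrightarrow> v = app2 f a b" using y uniq by blast
  qed
  show "app2 f a b \<epsilon> A" if "a \<epsilon> A" "b \<epsilon> A" for a b
  proof -
    have "pair a b \<in> dom_of f" using that by (auto simp: dom)
    then show ?thesis using im by (auto simp: app2_def)
  qed
qed

text \<open>The whole line is open because \<open>x\<close> lies strictly between
  \<open>x - 1\<close> and \<open>x + 1\<close>; the singleton of zero is not, because half of a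
  positive \<open>b\<close> lies strictly between zero and \<open>b\<close>.\<close>

lemma real_number_field_topology:
  assumes "real_number_field RR radd rmul rle"
  obtains K :: "'a ring" where "field K" "carrier K = elts RR" "mult K = app2 rmul" "add K = app2 radd"
    "real_open RR rle RR" "\<And>V. elts V = {zero K} \<Longrightarrow> \<not> real_open RR rle V"
proof -
  have lin: "linear_order_on (elts RR) {(x, y). rel rle x y}"
    and "\<exists>z u. field \<lparr>carrier = elts RR, mult = app2 rmul, one = u, zero = z, add = app2 radd\<rparr> \<and>
       (\<forall>x\<in>elts RR. \<forall>y\<in>elts RR. rel rle z x \<and> rel rle z y \<longrightarrow> rel rle z (app2 rmul x y))"
    and mono': "\<forall>x\<in>elts RR. \<forall>y\<in>elts RR. \<forall>w\<in>elts RR.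
       rel rle x y \<longrightarrow> rel rle (app2 radd x w) (app2 radd y w)"
    using assms unfolding real_number_field_def by blast+
  then obtain z u where
    fld: "field \<lparr>carrier = elts RR, mult = app2 rmul, one = u, zero = z, add = app2 radd\<rparr>"
    and nonneg: "\<forall>x\<in>elts RR. \<forall>y\<in>elts RR. rel rle z x \<and> rel rle z y \<longrightarrow> rel rle z (app2 rmul x y)"
    by blast
  define K where "K = \<lparr>carrier = elts RR, mult = app2 rmul, one = u, zero = z, add = app2 radd\<rparr>"
  interpret K: field K using fld by (simp add: K_def)
  have K: "carrier K = elts RR" "mult K = app2 rmul" "add K = app2 radd" "zero K = z"
    by (simp_all add: K_def)
  have car: "x \<epsilon> RR \<longleftrightarrow> x \<in> carrier K" for x by (simp add: K)
  have trans: "rel rle x w" if "rel rle x y" "rel rle y w" for x y w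
    using lin that by (auto simp: order_on_defs trans_def)
  have antisym: "x = y" if "rel rle x y" "rel rle y x" for x y
    using lin that by (auto simp: order_on_defs antisym_def)
  have total: "rel rle x y \<or> rel rle y x" if "x \<in> carrier K" "y \<in> carrier K" for x y
    using lin that unfolding K
    by (cases "x = y") (simp_all add: order_on_defs total_on_def refl_on_def del: elts_iff)
  have mono: "rel rle (x \<oplus>\<^bsub>K\<^esub> w) (y \<oplus>\<^bsub>K\<^esub> w)"
    if "rel rle x y" "x \<in> carrier K" "y \<in> carrier K" "w \<in> carrier K" for x y w
    using mono' that unfolding K by blast
  have pos: "rel rle \<zero>\<^bsub>K\<^esub> (x \<otimes>\<^bsub>K\<^esub> y)"
    if "rel rle \<zero>\<^bsub>K\<^esub> x" "rel rle \<zero>\<^bsub>K\<^esub> y" "x \<in> carrier K" "y \<in> carrier K" for x y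
    using nonneg that unfolding K by blast
  \<comment> \<open>Otherwise \<open>-1\<close> would be nonnegative, and so would its square, which
    is one.\<close>
  have one_pos: "rel rle \<zero>\<^bsub>K\<^esub> \<one>\<^bsub>K\<^esub>"
  proof (rule ccontr)
    assume neg: "\<not> rel rle \<zero>\<^bsub>K\<^esub> \<one>\<^bsub>K\<^esub>"
    then have "rel rle \<one>\<^bsub>K\<^esub> \<zero>\<^bsub>K\<^esub>" using total by blast
    then have "rel rle \<zero>\<^bsub>K\<^esub> (\<ominus>\<^bsub>K\<^esub> \<one>\<^bsub>K\<^esub>)"
      using mono[of "\<one>\<^bsub>K\<^esub>" "\<zero>\<^bsub>K\<^esub>" "\<ominus>\<^bsub>K\<^esub> \<one>\<^bsub>K\<^esub>"] by (simp add: K.r_neg)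
    then have "rel rle \<zero>\<^bsub>K\<^esub> (\<ominus>\<^bsub>K\<^esub> \<one>\<^bsub>K\<^esub> \<otimes>\<^bsub>K\<^esub> \<ominus>\<^bsub>K\<^esub> \<one>\<^bsub>K\<^esub>)" using pos by simp
    then show False using neg by (simp add: K.l_minus K.r_minus)
  qed
  have shift: "x \<noteq> y \<oplus>\<^bsub>K\<^esub> x" if "y \<noteq> \<zero>\<^bsub>K\<^esub>" "x \<in> carrier K" "y \<in> carrier K" for x y
    using that K.add.r_cancel_one'[of x y] by auto
  have lt_succ: "rel rle x (\<one>\<^bsub>K\<^esub> \<oplus>\<^bsub>K\<^esub> x)" "x \<noteq> \<one>\<^bsub>K\<^esub> \<oplus>\<^bsub>K\<^esub> x" if "x \<in> carrier K" for x
    using mono[OF one_pos, of x] shift[of "\<one>\<^bsub>K\<^esub>" x] that by auto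
  have op: "real_open RR rle RR"
    unfolding real_open_def
  proof (intro conjI ballI)
    fix x assume "x \<in> elts RR"
    then have x: "x \<in> carrier K" by (simp add: K)
    let ?a = "\<ominus>\<^bsub>K\<^esub> \<one>\<^bsub>K\<^esub> \<oplus>\<^bsub>K\<^esub> x" and ?b = "\<one>\<^bsub>K\<^esub> \<oplus>\<^bsub>K\<^esub> x"
    have "\<one>\<^bsub>K\<^esub> \<oplus>\<^bsub>K\<^esub> ?a = x" using x by (simp add: K.a_assoc[symmetric] K.r_neg)
    then have a: "rel rle ?a x" "?a \<noteq> x" using lt_succ[of ?a] x by auto
    have "?a \<in> elts RR" "?b \<in> elts RR" using x K by (metis K.add.m_closed K.add.inv_closed K.one_closed)+
    then show "\<exists>a\<in>elts RR. \<exists>b\<in>elts RR. rel rle a x \<and> a \<noteq> x \<and> rel rle x b \<and> x \<noteq> b \<and>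
        (\<forall>y\<in>elts RR. rel rle a y \<and> a \<noteq> y \<and> rel rle y b \<and> y \<noteq> b \<longrightarrow> y \<epsilon> RR)"
      using a lt_succ[OF x] by (intro bexI[of _ ?a] bexI[of _ ?b]) auto
  qed simp
  have not_open: "\<not> real_open RR rle V" if V: "elts V = {zero K}" for V
  proof
    assume "real_open RR rle V"
    then have "\<exists>a\<in>carrier K. \<exists>b\<in>carrier K. rel rle a \<zero>\<^bsub>K\<^esub> \<and> a \<noteq> \<zero>\<^bsub>K\<^esub> \<and> rel rle \<zero>\<^bsub>K\<^esub> b \<and> \<zero>\<^bsub>K\<^esub> \<noteq> b \<and>
        (\<forall>y\<in>carrier K. rel rle a y \<and> a \<noteq> y \<and> rel rle y b \<and> y \<noteq> b \<longrightarrow> y \<epsilon> V)"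
      unfolding real_open_def K(1) V by (simp del: elts_iff)
    then obtain a b where ab: "a \<in> carrier K" "b \<in> carrier K"
      "rel rle a \<zero>\<^bsub>K\<^esub>" "a \<noteq> \<zero>\<^bsub>K\<^esub>" "rel rle \<zero>\<^bsub>K\<^esub> b" "\<zero>\<^bsub>K\<^esub> \<noteq> b"
      and sub: "\<And>y. y \<in> carrier K \<Longrightarrow> rel rle a y \<Longrightarrow> a \<noteq> y \<Longrightarrow> rel rle y b \<Longrightarrow> y \<noteq> b \<Longrightarrow> y \<epsilon> V"
      by (elim bexE conjE) blast
    let ?t = "\<one>\<^bsub>K\<^esub> \<oplus>\<^bsub>K\<^esub> \<one>\<^bsub>K\<^esub>"
    \<comment> \<open>If \<open>1 + 1 = 0\<close>, then \<open>1 \<le> 1 + 1 = 0 \<le> 1\<close>,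
      which gives \<open>0 = 1\<close>.\<close>
    have "?t \<noteq> \<zero>\<^bsub>K\<^esub>"
      using lt_succ(1)[of "\<one>\<^bsub>K\<^esub>"] one_pos antisym K.one_not_zero by fastforce
    then have tU: "?t \<in> Units K" using K.field_Units by simp
    \<comment> \<open>\<open>y\<close> is half of \<open>b\<close>, the nonzero point of the
      interval that refutes openness.\<close>
    define y where "y = b \<otimes>\<^bsub>K\<^esub> inv\<^bsub>K\<^esub> ?t"
    have y: "y \<in> carrier K" using tU ab by (simp add: y_def)
    have "y \<otimes>\<^bsub>K\<^esub> ?t = b" using tU ab by (simp add: y_def K.m_assoc)
    then have yy: "y \<oplus>\<^bsub>K\<^esub> y = b" using y by (simp add: K.r_distr)
    have y0: "y \<noteq> \<zero>\<^bsub>K\<^esub>" using yy ab by auto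
    \<comment> \<open>From \<open>y \<le> 0\<close> one gets
      \<open>b = y + y \<le> y \<le> 0\<close>, against \<open>b\<close> being positive.\<close>
    have ypos: "rel rle \<zero>\<^bsub>K\<^esub> y"
    proof (rule ccontr)
      assume "\<not> rel rle \<zero>\<^bsub>K\<^esub> y"
      then have "rel rle y \<zero>\<^bsub>K\<^esub>" using total y by blast
      moreover from mono[OF this, of y] have "rel rle b y" using y yy by simp
      ultimately show False using trans antisym ab by metis
    qed
    have "rel rle y b" using mono[OF ypos, of y] y yy by simp
    moreover have "y \<noteq> b" using shift[of y y] y0 y yy by auto
    moreover have "rel rle a y" using trans ab ypos by blast
    moreover have "a \<noteq> y" using ab ypos antisym by metis
    ultimately have "y \<in> elts V" using sub y by simp
    then show False using y0 V by simp
  qed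
  show ?thesis by (rule that[of K]) (use K op not_open K.field_axioms in auto)
qed

end

section \<open>Reduction of the arithmetic to the algebraic situation\<close>

theorem theorem11:
  fixes mem :: "'c \<Rightarrow> 'c \<Rightarrow> bool" and RR radd rmul rle :: 'c
  assumes "THS mem"
    and "membership.real_number_field mem RR radd rmul rle"
  shows "\<not> (\<exists>r oplus odot Rb rho.
    membership.hyperfinite_computer_arithmetic mem RR radd rmul rle r oplus odot Rb rho \<and>
    associative_ring (membership.elts mem r)
      (membership.app2 mem oplus) (membership.app2 mem odot))"
proof (rule notI, elim exE conjE)
  interpret THS mem by fact
  fix r oplus odot Rb rho
  assume hca: "hyperfinite_computer_arithmetic RR radd rmul rle r oplus odot Rb rho"
    and ring: "associative_ring (elts r) (app2 oplus) (app2 odot)"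
  have sets: "isset r" "isset oplus" "isset odot" and binop: "binop_on oplus r" "binop_on odot r"
    and Rb_r: "elts Rb \<subseteq> elts r" and pi: "pi_class rho"
    and eqv: "equiv (elts r) {(a, b). rel rho a b}"
    and closed: "\<forall>a\<in>elts Rb. \<forall>b\<in>elts Rb. mem (app2 oplus a b) Rb \<and> mem (app2 odot a b) Rb"
    and cong: "\<forall>a\<in>elts Rb. \<forall>a'\<in>elts Rb. \<forall>b\<in>elts Rb. \<forall>b'\<in>elts Rb.
        rel rho a a' \<and> rel rho b b' \<longrightarrow>
        rel rho (app2 oplus a b) (app2 oplus a' b') \<and> rel rho (app2 odot a b) (app2 odot a' b')"
    and "\<exists>N F. thin N \<and> transversal Rb rho N \<and>
        quotient_isomorphism RR radd rmul rle oplus odot Rb rho N F"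
    using hca unfolding hyperfinite_computer_arithmetic_def by blast+
  then obtain N F where tv: "transversal Rb rho N"
    and iso: "quotient_isomorphism RR radd rmul rle oplus odot Rb rho N F" by blast
  obtain K :: "'c ring" where K: "field K" "carrier K = elts RR" "mult K = app2 rmul" "add K = app2 radd"
    and open_RR: "real_open RR rle RR" and not_open: "\<And>V. elts V = {zero K} \<Longrightarrow> \<not> real_open RR rle V"
    using real_number_field_topology[OF assms(2)] by blast
  interpret K: field K by fact
  have bij: "bij_betw (app F) (elts N) (elts RR)"
    and hom: "\<And>a b. a \<in> elts N \<Longrightarrow> b \<in> elts N \<Longrightarrow>
        app F (representative rho N (app2 oplus a b)) = app2 radd (app F a) (app F b) \<and>
        app F (representative rho N (app2 odot a b)) = app2 rmul (app F a) (app F b)"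
    and homeo: "\<And>W V. elts W \<subseteq> elts N \<Longrightarrow> elts V = app F ` elts W \<Longrightarrow>
        quotient_open Rb rho N W \<longleftrightarrow> real_open RR rle V"
    using iso unfolding quotient_isomorphism_def by blast+
  have inj: "inj_on (app F) (elts N)" and im: "app F ` elts N = elts RR"
    using bij by (auto simp: bij_betw_def)
  have sym: "rel rho b a" if "rel rho a b" for a b using eqv that by (auto simp: equiv_def sym_def)
  have trans: "rel rho a c" if "rel rho a b" "rel rho b c" for a b c
    using eqv that by (auto simp: equiv_def trans_def)
  have refl: "rel rho a a" if "a \<in> elts Rb" for a
    using eqv that Rb_r by (auto simp: equiv_def refl_on_def)
  have N_Rb: "elts N \<subseteq> elts Rb" and ex1: "\<And>a. a \<in> elts Rb \<Longrightarrow> \<exists>!n. mem n N \<and> rel rho a n"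
    using tv unfolding transversal_def by blast+
  let ?rep = "representative rho N"
  have rep: "?rep a \<in> elts N" "rel rho a (?rep a)" if "a \<in> elts Rb" for a
    using theI'[OF ex1[OF that]] by (simp_all add: representative_def)
  have rep_eq: "?rep a = n" if "a \<in> elts Rb" "n \<in> elts N" "rel rho a n" for a n
    using ex1[OF that(1)] rep[OF that(1)] that(2,3) by auto
  have rep_iff: "?rep a = ?rep b \<longleftrightarrow> rel rho a b" if "a \<in> elts Rb" "b \<in> elts Rb" for a b
    using rep that rep_eq[of a "?rep b"] sym trans by metis
  \<comment> \<open>Choosing the representative in \<open>N\<close> and applying the isomorphism
    gives a map on all of \<open>Rb\<close> whose fibres are the \<open>rho\<close>-classes.\<close>
  define h where "h a = app F (?rep a)" for a
  have h_iff: "h a = h b \<longleftrightarrow> rel rho a b" if "a \<in> elts Rb" "b \<in> elts Rb" for a b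
    using rep_iff[OF that] rep(1)[OF that(1)] rep(1)[OF that(2)] inj by (auto simp: h_def inj_on_eq_iff)
  have h_N: "h n = app F n" if "n \<in> elts N" for n
    using rep_eq[of n n] that N_Rb refl by (auto simp: h_def)
  have h_surj: "h ` elts Rb = carrier K"
  proof
    show "h ` elts Rb \<subseteq> carrier K" using rep(1) im by (auto simp: h_def K)
    show "carrier K \<subseteq> h ` elts Rb"
      using im h_N N_Rb by (metis (no_types, lifting) K(2) image_cong image_mono)
  qed
  have h_hom: "h (app2 oplus a b) = app2 radd (h a) (h b)" "h (app2 odot a b) = app2 rmul (h a) (h b)"
    if ab: "a \<in> elts Rb" "b \<in> elts Rb" for a b
  proof -
    have N: "?rep a \<in> elts N" "?rep b \<in> elts N" using ab rep by auto
    then have Rb: "?rep a \<in> elts Rb" "?rep b \<in> elts Rb" using N_Rb by auto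
    have "rel rho (app2 oplus a b) (app2 oplus (?rep a) (?rep b)) \<and>
        rel rho (app2 odot a b) (app2 odot (?rep a) (?rep b))"
      using cong ab Rb rep(2) by blast
    moreover have "app2 oplus a b \<in> elts Rb" "app2 odot a b \<in> elts Rb"
      "app2 oplus (?rep a) (?rep b) \<in> elts Rb" "app2 odot (?rep a) (?rep b) \<in> elts Rb"
      using closed ab Rb by auto
    ultimately have "h (app2 oplus a b) = h (app2 oplus (?rep a) (?rep b))"
      "h (app2 odot a b) = h (app2 odot (?rep a) (?rep b))"
      using h_iff by blast+
    then show "h (app2 oplus a b) = app2 radd (h a) (h b)" "h (app2 odot a b) = app2 rmul (h a) (h b)"
      using hom[OF N] by (simp_all add: h_def)
  qed
  obtain z where z: "z \<in> elts N" "app F z = \<zero>\<^bsub>K\<^esub>"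
    using im K(2) K.zero_closed by (metis imageE)
  obtain e where e: "e \<in> elts N" "app F e = \<one>\<^bsub>K\<^esub>"
    using im K(2) K.one_closed by (metis imageE)
  have zR: "z \<in> elts Rb" and eR: "e \<in> elts Rb" using z e N_Rb by auto
  have set: "isset z" "isset e" using z e isset_mem by auto
  have h0: "h a = \<zero>\<^bsub>K\<^esub> \<longleftrightarrow> rel rho z a" and h1: "h a = \<one>\<^bsub>K\<^esub> \<longleftrightarrow> rel rho a e" if "a \<in> elts Rb" for a
    using h_iff[OF zR that] h_iff[OF that eR] h_N z e by metis+
  let ?S = "{a \<in> elts Rb. h a = \<zero>\<^bsub>K\<^esub>}"
  obtain u where u: "isset u" "elts u \<subseteq> elts Rb" "?S \<subseteq> elts u"
  proof -
    \<comment> \<open>Openness of the whole quotient yields a basic neighbourhood of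
      \<open>z\<close>. Since \<open>z\<close> is in the accented part of \<open>u\<close>, its
      entire \<open>rho\<close>-class, the kernel of \<open>h\<close>, is contained in
      \<open>u\<close>.\<close>
    have "quotient_open Rb rho N N" using homeo[of N RR] im open_RR by simp
    then obtain u where "isset u" "elts u \<subseteq> elts Rb" "z \<in> ring_interior Rb rho u"
      using z(1) unfolding quotient_open_def by blast
    then show ?thesis using h0 by (intro that[of u]) (auto simp: ring_interior_def)
  qed
  have rel_pair: "rel rho a b \<longleftrightarrow> mem (pair a b) rho" if "a \<in> elts Rb" "b \<in> elts Rb" for a b
    using that isset_mem by (auto simp: rel_def)
  have ze: "\<not> rel rho z e" using h0[OF eR] h_N e by auto
  \<comment> \<open>\<open>u\<close> is shrunk to discard the fibre over one. The fibres of
    \<open>z\<close> and \<open>e\<close> are disjoint, for a common element would give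
    \<open>0 = 1\<close> by transitivity.\<close>
  obtain u0 where u0: "isset u0" "elts u0 \<subseteq> elts u"
    "\<And>s. mem s u \<Longrightarrow> mem (pair z s) rho \<Longrightarrow> mem s u0" "\<And>s. mem s u0 \<Longrightarrow> \<not> mem (pair s e) rho"
  proof (rule pi_class_separation[OF pi u(1) set])
    show "\<not> mem (pair z e) rho" using ze rel_pair zR eR by blast
    show "\<not> mem (pair s e) rho" if "mem s u" "mem (pair z s) rho" for s
    proof -
      have "s \<in> elts Rb" using that u(2) by auto
      then show ?thesis using that rel_pair zR eR ze trans by blast
    qed
  qed blast
  obtain zr where rng: "rng \<lparr>carrier = elts r, mult = app2 odot, one = undefined, zero = zr, add = app2 oplus\<rparr>"
    using rng_of_associative_ring[OF ring] by blast
  show False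
  proof (rule no_set_ring_with_nondiscrete_field_quotient[OF rng K(1) sets(1), where pl = oplus and ml = odot and Rb = "elts Rb" and h = h and u = u0])
    show "elts u0 \<subseteq> elts Rb" using u0 u by blast
    show "?S \<subseteq> elts u0"
    proof
      fix a assume a: "a \<in> ?S"
      then have "mem (pair z a) rho" using h0 rel_pair zR by blast
      then show "a \<in> elts u0" using u0(3) a u(3) by auto
    qed
    show "h a \<noteq> \<one>\<^bsub>K\<^esub>" if "mem a u0" for a
    proof -
      have "a \<in> elts Rb" using that u0(2) u(2) elts_iff by blast
      then show ?thesis using h1 rel_pair eR u0(4)[OF that] by blast
    qed
    \<comment> \<open>A kernel that is a set would be saturated and meet \<open>N\<close> only in
      \<open>z\<close>. Then the singleton of \<open>z\<close> would be open, and by the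
      homeomorphism so would the singleton of zero in the real line.\<close>
    show "elts S \<noteq> ?S" if S: "isset S" for S
    proof
      assume eq: "elts S = ?S"
      let ?W = "adjoin empty_class z" and ?V = "adjoin empty_class \<zero>\<^bsub>K\<^esub>"
      have "isset \<zero>\<^bsub>K\<^esub>" using K.zero_closed isset_mem unfolding K(2) elts_iff by blast
      then have V: "elts ?V = {\<zero>\<^bsub>K\<^esub>}" and W: "elts ?W = {z}" using set by auto
      have int: "ring_interior Rb rho S \<inter> elts N = {z}"
      proof (intro equalityI subsetI)
        fix a assume "a \<in> ring_interior Rb rho S \<inter> elts N"
        then have "a \<in> elts S" "a \<in> elts N" by (auto simp: ring_interior_def)
        then have "app F a = app F z" using eq h_N z by auto
        then show "a \<in> {z}" using inj \<open>a \<in> elts N\<close> z(1) by (auto simp: inj_on_def)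
      next
        fix a assume "a \<in> {z}"
        moreover have "z \<in> elts S" using eq zR h_N z by auto
        moreover have "mem b S" if "b \<in> elts Rb" "rel rho z b" for b
          using that h0 eq by (metis (mono_tags, lifting) elts_iff mem_Collect_eq)
        ultimately show "a \<in> ring_interior Rb rho S \<inter> elts N" using z(1) by (auto simp: ring_interior_def)
      qed
      have "quotient_open Rb rho N ?W"
        unfolding quotient_open_def W
        using S z(1) int eq by (auto intro!: exI[of _ S])
      then have "real_open RR rle ?V" using homeo[of ?W ?V] V W z by simp
      then show False using not_open V by blast
    qed
  qed (use sets binop_on_graph2 binop Rb_r closed h_surj h_hom u0 in \<open>auto simp: K\<close>)
qed

end
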